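(* Let $\chi$ be a non-principal even primitive Dirichlet character modulo $q$, and let $a,x>0$ with $\frac{a^2 q x}{16 \pi^2}\notin \mathbb{Z}_{>0}$. Then \begin{align*} \sum_{n=1}^\infty d_{\chi}(n) K_0(a\sqrt{nx})= \frac{2}{a^2x} L(1,\chi)-\frac{\tau(\chi)}{8 }L (1,\bar{\chi}) + \frac{a^2q\, x}{32\pi^4} \tau( \chi ) \sum_{n=1}^\infty d_{\bar{\chi} }(n) \frac{\log \left(\frac{16\pi^2 n}{a^2q x} \right) }{n^2-\left(\frac{a^2qx}{16\pi^2 } \right)^2}. \end{align*}
   Context: $d_\chi(n)=\sum_{d\mid n}\chi(d)$. $\tau(\chi)=\sum_{h=1}^q\chi(h)e^{2\pi i h/q}$ is the Gauss sum, $L(s,\chi)$ the Dirichlet $L$-function, and $K_0$ the modified Bessel function of the second kind of order $0$. *)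

theory Defs
  imports "HOL-Analysis.Analysis" "HOL-Number_Theory.Cong"
begin

definition dirichlet_character :: "nat \<Rightarrow> (int \<Rightarrow> complex) \<Rightarrow> bool" where
  "dirichlet_character q chi \<longleftrightarrow> q > 0 \<and>
     (\<forall>m n. chi (m * n) = chi m * chi n) \<and>
     (\<forall>n. chi (n + int q) = chi n) \<and>
     (\<forall>n. chi n = 0 \<longleftrightarrow> \<not> coprime n (int q))"

definition principal_character :: "nat \<Rightarrow> (int \<Rightarrow> complex) \<Rightarrow> bool" where
  "principal_character q chi \<longleftrightarrow> (\<forall>n. coprime n (int q) \<longrightarrow> chi n = 1)"

definition primitive_character :: "nat \<Rightarrow> (int \<Rightarrow> complex) \<Rightarrow> bool" where
  "primitive_character q chi \<longleftrightarrow> dirichlet_character q chi \<and>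
     (\<forall>d. d dvd q \<and> d < q \<longrightarrow>
        \<not> (\<forall>n. coprime n (int q) \<and> [n = 1] (mod int d) \<longrightarrow> chi n = 1))"

definition even_character :: "(int \<Rightarrow> complex) \<Rightarrow> bool" where
  "even_character chi \<longleftrightarrow> chi (-1) = 1"

definition conj_character :: "(int \<Rightarrow> complex) \<Rightarrow> (int \<Rightarrow> complex)" where
  "conj_character chi = (\<lambda>n. cnj (chi n))"

definition d_chi :: "(int \<Rightarrow> complex) \<Rightarrow> nat \<Rightarrow> complex" where
  "d_chi chi n = (\<Sum>d | d dvd n. chi (int d))"

definition gauss_sum :: "nat \<Rightarrow> (int \<Rightarrow> complex) \<Rightarrow> complex" where
  "gauss_sum q chi = (\<Sum>h = 1..q. chi (int h) * exp (2 * pi * \<i> * of_nat h / of_nat q))"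

text \<open>L(1,chi) for a non-principal character, as the (convergent) Dirichlet series.\<close>
definition dirichlet_L_one :: "(int \<Rightarrow> complex) \<Rightarrow> complex" where
  "dirichlet_L_one chi = (\<Sum>n. chi (int (Suc n)) / of_nat (Suc n))"

definition bessel_K0 :: "real \<Rightarrow> real" where
  "bessel_K0 x = integral {0..} (\<lambda>t. exp (- x * cosh t))"

end

theory Submission
  imports Defs "HOL-Number_Theory.Residues" "HOL-Real_Asymp.Real_Asymp"
begin

text \<open>
  Put $c = a\sqrt{x}/2$. Since $2 K_0(2c\sqrt{dm}) = \int_0^\infty e^{-cdu - cm/u}\,du/u$, twice the
  left-hand side is $\int_0^\infty \theta(u)\,(e^{c/u}-1)^{-1}\,du/u$ with
  $\theta(u) = \sum_d \chi(d) e^{-cdu}$. The partial fraction expansion of $1/(e^w-1)$, used once directly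
  and once together with the finite Fourier expansion of $\chi$, gives
  $(e^{c/u}-1)^{-1} = u/c - 1/2 + \sum_k 2cu/(c^2+(2\pi k u)^2)$ and
  $\theta(u)/u = (\tau(\chi)/q) \sum_n \bar\chi(n)\, 2c/((cu)^2+(2\pi n/q)^2)$.
  The three summands of the first expansion produce the three terms on the right-hand side. The first two
  sums over the character converge only conditionally; they are integrated termwise by dominated convergence,
  Abel summation providing the majorant. The last one converges absolutely, and its terms integrate to
  logarithms.
\<close>

subsection \<open>Dirichlet characters and Gauss sums\<close>

text \<open>No single interchange of sum and integral evaluates the integral. The functions
  \<open>exp (- c * d * u) / u\<close> are not integrable at 0, so the exponential series for
  \<open>theta u / u\<close> serves only against the summand \<open>u / c\<close>, where the factor
  \<open>1 / u\<close> cancels. Against the other two summands the transformed series is used, whose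
  terms are integrable on the whole half-line. Evenness lets the frequencies m and -m merge into a
  real positive kernel; non-principality cancels the constants 1/2 of the partial fractions and
  bounds the partial sums of the character. Fourier inversion writes the character through its
  conjugate, which is why the conjugate appears in the last two terms and why both carry the Gauss
  sum. In the double sum the frequencies A = 2 pi m / q and B = 2 pi k enter the value of the
  integral only through A B = 4 pi^2 m k / q, so grouping by m k produces the divisor sum. The
  excluded values of a^2 q x / (16 pi^2) are those with A B = c^2 for some m, k: there the
  logarithmic quotient becomes 0/0, which HOL evaluates to 0 and not to its limit.\<close>

lemma periodic_int_mult:
  fixes f :: "int \<Rightarrow> 'a"
  assumes "\<And>n. f (n + q) = f n"
  shows "f (n + k * q) = f n"
proof (induction k rule: int_induct[of _ 0])
  case base
  then show ?case by simp
next
  case (step1 i)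
  then show ?case using assms[of "n + i * q"] by (simp add: algebra_simps)
next
  case (step2 i)
  then show ?case using assms[of "n + (i - 1) * q"] by (simp add: algebra_simps)
qed

lemma periodic_int_mod:
  fixes f :: "int \<Rightarrow> 'a"
  assumes "\<And>n. f (n + q) = f n"
  shows "f (n mod q) = f n"
  using periodic_int_mult[of f q "n mod q" "n div q", OF assms] by simp

lemma periodic_int_cong:
  fixes f :: "int \<Rightarrow> 'a"
  assumes "\<And>n. f (n + q) = f n" and "[m = n] (mod q)"
  shows "f m = f n"
  by (metis assms cong_def periodic_int_mod)

text \<open>A unit permutes the residues: multiplication followed by reduction is injective on a
  finite set, hence onto. This is the substitution behind the vanishing of character sums and both
  cases of the separability of Gauss sums.\<close>

lemma sum_periodic_coprime_mult:
  fixes f :: "int \<Rightarrow> 'a::comm_monoid_add"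
  assumes per: "\<And>n. f (n + q) = f n" and "coprime m q" and "q > 0"
  shows "(\<Sum>h\<in>{0..<q}. f (m * h)) = (\<Sum>h\<in>{0..<q}. f h)"
proof -
  have inj: "inj_on (\<lambda>h. (m * h) mod q) {0..<q}"
  proof (rule inj_onI)
    fix x y assume xy: "x \<in> {0..<q}" "y \<in> {0..<q}" "(m * x) mod q = (m * y) mod q"
    then have "[m * x = m * y] (mod q)" by (simp add: cong_def)
    then have "[x = y] (mod q)" using assms(2) by (simp add: cong_mult_lcancel)
    then show "x = y" using xy by (simp add: cong_def)
  qed
  have sub: "(\<lambda>h. (m * h) mod q) ` {0..<q} \<subseteq> {0..<q}"
    using assms(3) by auto
  have bij: "bij_betw (\<lambda>h. (m * h) mod q) {0..<q} {0..<q}"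
    unfolding bij_betw_def using inj sub endo_inj_surj[of "{0..<q}"] by auto
  have "(\<Sum>h\<in>{0..<q}. f (m * h)) = (\<Sum>h\<in>{0..<q}. f ((m * h) mod q))"
    by (simp add: periodic_int_mod[of f q, OF per])
  also have "\<dots> = (\<Sum>h\<in>{0..<q}. f h)"
    by (rule sum.reindex_bij_betw[OF bij])
  finally show ?thesis .
qed

text \<open>Bridges the range 1..q of \<open>gauss_sum\<close> and the residue system 0..<q, which
  suits \<open>mod\<close>; periodicity trades the endpoint q for 0.\<close>

lemma sum_periodic_nat_int:
  fixes f :: "int \<Rightarrow> 'a::comm_monoid_add"
  assumes per: "\<And>n. f (n + int q) = f n" and "q > 0"
  shows "(\<Sum>h = 1..q. f (int h)) = (\<Sum>h\<in>{0..<int q}. f h)"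
proof -
  have "(\<Sum>h = 1..q. f (int h)) = (\<Sum>h\<in>{1..<q}. f (int h)) + f (int q)"
    using assms(2) by (simp add: sum.last_plus add.commute)
  also have "f (int q) = f (int 0)" using per[of 0] by simp
  also have "(\<Sum>h\<in>{1..<q}. f (int h)) + f (int 0) = (\<Sum>h\<in>{0..<q}. f (int h))"
    using assms(2) by (simp add: sum.atLeast_Suc_lessThan add.commute)
  also have "\<dots> = (\<Sum>h\<in>int ` {0..<q}. f h)"
    by (simp add: sum.reindex)
  also have "int ` {0..<q} = {0..<int q}" by (simp add: image_int_atLeastLessThan)
  finally show ?thesis .
qed

text \<open>The additive character e(k/q). The argument is an integer, so that negative frequencies
  are allowed and the periodicity lemmas for integer functions apply.\<close>

definition root_char :: "nat \<Rightarrow> int \<Rightarrow> complex" where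
  "root_char q k = exp (2 * pi * \<i> * of_int k / of_nat q)"

lemma root_char_add: "root_char q (j + k) = root_char q j * root_char q k"
  by (simp add: root_char_def flip: exp_add) (simp add: add_divide_distrib algebra_simps)

lemma root_char_0 [simp]: "root_char q 0 = 1"
  by (simp add: root_char_def)

lemma root_char_eq_1_iff:
  assumes "q > 0"
  shows "root_char q k = 1 \<longleftrightarrow> int q dvd k"
proof -
  have "root_char q k = 1 \<longleftrightarrow> (\<exists>n::int. 2 * pi * of_int k / of_nat q = of_int (2 * n) * pi)"
    unfolding root_char_def by (subst exp_eq_1) simp
  also have "\<dots> \<longleftrightarrow> (\<exists>n::int. real_of_int k = of_int (n * int q))"
    using assms by (simp add: field_simps)
  also have "\<dots> \<longleftrightarrow> int q dvd k"
    unfolding of_int_eq_iff by (auto simp: dvd_def mult.commute)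
  finally show ?thesis .
qed

lemma root_char_periodic: "q > 0 \<Longrightarrow> root_char q (k + int q) = root_char q k"
  by (simp add: root_char_add root_char_eq_1_iff)

lemma root_char_mult_nat: "root_char q (k * int n) = root_char q k ^ n"
  by (induction n) (simp_all add: algebra_simps root_char_add)

lemma root_char_orthogonal:
  assumes "q > 0"
  shows "(\<Sum>n\<in>{0..<int q}. root_char q (k * n)) = (if int q dvd k then of_nat q else 0)"
proof -
  have "(\<Sum>n\<in>{0..<int q}. root_char q (k * n)) = (\<Sum>n\<in>int ` {0..<q}. root_char q (k * n))"
    by (simp add: image_int_atLeastLessThan)
  also have "\<dots> = (\<Sum>n<q. root_char q k ^ n)"
    by (simp add: sum.reindex root_char_mult_nat atLeast0LessThan)
  also have "\<dots> = (if int q dvd k then of_nat q else 0)"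
  proof (cases "int q dvd k")
    case True
    then show ?thesis using assms by (simp add: root_char_eq_1_iff[THEN iffD2])
  next
    case False
    then have "root_char q k \<noteq> 1" using assms root_char_eq_1_iff by blast
    moreover have "root_char q k ^ q = 1"
      using root_char_eq_1_iff[OF assms, of "k * int q"] by (simp add: root_char_mult_nat)
    ultimately show ?thesis using False by (simp add: geometric_sum)
  qed
  finally show ?thesis .
qed

section \<open>Multiplicative characters: absolute values and partial sums\<close>

locale dchar =
  fixes q :: nat and chi :: "int \<Rightarrow> complex"
  assumes dchar: "dirichlet_character q chi"
begin

lemma q_pos: "q > 0" and chi_mult: "chi (m * n) = chi m * chi n"
  and chi_periodic: "chi (n + int q) = chi n"
  and chi_zero_iff: "chi n = 0 \<longleftrightarrow> \<not> coprime n (int q)"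
  using dchar by (auto simp: dirichlet_character_def)

lemma chi_one: "chi 1 = 1"
  using chi_mult[of 1 1] chi_zero_iff[of 1] by simp

lemma chi_power: "chi (n ^ k) = chi n ^ k"
  by (induction k) (simp_all add: chi_one chi_mult)

text \<open>By Euler's theorem the value is a root of unity. That theorem is about natural numbers,
  hence the detour through the residue \<open>m\<close>.\<close>

lemma norm_chi_eq_1:
  assumes "coprime n (int q)"
  shows "norm (chi n) = 1"
proof -
  define m where "m = nat (n mod int q)"
  have m: "int m = n mod int q" using q_pos by (simp add: m_def)
  have "coprime (n mod int q) (int q)" using assms q_pos by (simp add: coprime_mod_left_iff)
  then have "coprime m q" by (simp flip: m)
  then have "[m ^ totient q = 1] (mod q)" by (rule euler_theorem)
  then have "[int m ^ totient q = 1] (mod int q)"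
    by (metis cong_int_iff of_nat_1 of_nat_power)
  then have "chi (int m ^ totient q) = chi 1"
    by (rule periodic_int_cong[of chi, OF chi_periodic])
  moreover have "chi (int m) = chi n"
    unfolding m by (rule periodic_int_mod[of chi, OF chi_periodic])
  ultimately have "chi n ^ totient q = 1" by (simp add: chi_power chi_one)
  then have "norm (chi n) ^ totient q = 1" by (metis norm_one norm_power)
  moreover have "totient q > 0" using q_pos by simp
  ultimately show ?thesis
    using power_eq_imp_eq_base[of "norm (chi n)" "totient q" 1] by simp
qed

lemma norm_chi_le_1: "norm (chi n) \<le> 1"
  using norm_chi_eq_1[of n] chi_zero_iff[of n] by (cases "coprime n (int q)") auto

lemma sum_chi_eq_0:
  assumes "\<not> principal_character q chi"
  shows "(\<Sum>h\<in>{0..<int q}. chi h) = 0"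
proof -
  obtain m where m: "coprime m (int q)" "chi m \<noteq> 1"
    using assms unfolding principal_character_def by blast
  have "(\<Sum>h\<in>{0..<int q}. chi h) = (\<Sum>h\<in>{0..<int q}. chi (m * h))"
    using sum_periodic_coprime_mult[of chi "int q" m] m q_pos chi_periodic by simp
  also have "\<dots> = chi m * (\<Sum>h\<in>{0..<int q}. chi h)"
    by (simp add: chi_mult sum_distrib_left)
  finally show ?thesis using m(2) by (metis mult_cancel_right1)
qed

text \<open>A full period sums to 0, so blocks of length q can be split off until fewer than q terms
  remain, each of norm at most 1. The bound is the constant fed into Abel summation later.\<close>

lemma norm_sum_chi_le:
  assumes "\<not> principal_character q chi"
  shows "norm (\<Sum>n<N. chi (int (Suc n))) \<le> real q"
proof (induction N rule: less_induct)
  case (less N)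
  show ?case
  proof (cases "N < q")
    case True
    have "norm (\<Sum>n<N. chi (int (Suc n))) \<le> (\<Sum>n<N. 1)"
      by (rule sum_norm_le) (rule norm_chi_le_1)
    then show ?thesis using True by simp
  next
    case False
    then obtain M where M: "N = q + M" by (metis le_iff_add not_less)
    have "(\<Sum>n<q + M. chi (int (Suc n))) = (\<Sum>n<q. chi (int (Suc n))) + (\<Sum>n<M. chi (int (Suc n)))"
    proof (induction M)
      case (Suc M)
      have "chi (int (Suc (q + M))) = chi (int (Suc M))"
        using chi_periodic[of "int (Suc M)"] by (simp add: algebra_simps)
      then show ?case using Suc by simp
    qed simp
    moreover have "(\<Sum>n<q. chi (int (Suc n))) = (\<Sum>h = 1..q. chi (int h))"
      by (rule sum.reindex_bij_witness[of _ "\<lambda>h. h - 1" Suc]) auto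
    then have "(\<Sum>n<q. chi (int (Suc n))) = 0"
      using sum_periodic_nat_int[of chi, OF chi_periodic q_pos] sum_chi_eq_0[OF assms] by simp
    ultimately show ?thesis using less.IH[of M] M q_pos by simp
  qed
qed

end

section \<open>Gauss sums and the finite Fourier expansion of a primitive character\<close>

locale primitive_dchar = dchar +
  assumes primitive: "primitive_character q chi"
begin

lemma gauss_sum_alt: "gauss_sum q chi = (\<Sum>h\<in>{0..<int q}. chi h * root_char q h)"
  unfolding gauss_sum_def
  using sum_periodic_nat_int[of "\<lambda>h. chi h * root_char q h" q] q_pos
  by (simp add: chi_periodic root_char_periodic) (simp add: root_char_def)

text \<open>For n coprime to q, substitute n h for h and cancel \<open>chi n\<close> against its
  conjugate. Otherwise the right-hand side is 0, and primitivity makes the left-hand side vanish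
  too: with d = q / gcd(n, q) < q there is a unit m = 1 modulo d with \<open>chi m\<close> different
  from 1, and substituting m h multiplies the sum by \<open>chi m\<close>.\<close>

lemma gauss_sum_separable:
  "(\<Sum>h\<in>{0..<int q}. chi h * root_char q (h * n)) = cnj (chi n) * gauss_sum q chi"
proof (cases "coprime n (int q)")
  case True
  define G where "G = (\<Sum>h\<in>{0..<int q}. chi h * root_char q (h * n))"
  have "gauss_sum q chi = (\<Sum>h\<in>{0..<int q}. chi (n * h) * root_char q (n * h))"
    unfolding gauss_sum_alt
    using sum_periodic_coprime_mult[of "\<lambda>h. chi h * root_char q h" "int q" n] True q_pos
    by (simp add: chi_periodic root_char_periodic)
  also have "\<dots> = chi n * G"
    by (simp add: G_def chi_mult sum_distrib_left mult_ac)
  finally have "cnj (chi n) * gauss_sum q chi = (chi n * cnj (chi n)) * G" by simp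
  also have "chi n * cnj (chi n) = 1"
    using norm_chi_eq_1[OF True] by (simp add: complex_norm_square[symmetric])
  finally show ?thesis by (simp add: G_def)
next
  case False
  define g where "g = nat (gcd n (int q))"
  have g: "int g = gcd n (int q)" by (simp add: g_def)
  have g1: "g > 1" using False q_pos g
    by (cases g rule: nat.exhaust) (auto simp: coprime_iff_gcd_eq_1)
  have "int g dvd int q" "int g dvd n" using g by simp_all
  then obtain d n' where d: "q = g * d" and n': "n = int g * n'"
    by (metis dvdE of_nat_dvd_iff)
  have "d dvd q" "d < q" using d g1 q_pos by auto
  then obtain m where m: "coprime m (int q)" "[m = 1] (mod int d)" "chi m \<noteq> 1"
    using primitive unfolding primitive_character_def by blast
  \<comment> \<open>Multiplication by $m$ fixes $h \mapsto e(hn/q)$, which depends only on $h$ modulo $d$, but not the character.\<close>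
  have e: "root_char q (m * h * n) = root_char q (h * n)" for h
  proof (rule periodic_int_cong[of _ "int q"])
    have "int d dvd m - 1" using m(2) by (simp add: cong_iff_dvd_diff)
    then have "int q dvd (m - 1) * (h * n)"
      unfolding d n' by (auto simp: dvd_def)
    then show "[m * h * n = h * n] (mod int q)"
      by (simp add: cong_iff_dvd_diff algebra_simps)
  qed (simp add: root_char_periodic q_pos)
  define G where "G = (\<Sum>h\<in>{0..<int q}. chi h * root_char q (h * n))"
  have per: "root_char q ((h + int q) * n) = root_char q (h * n)" for h
    by (rule periodic_int_cong[of _ "int q"])
       (simp_all add: root_char_periodic q_pos cong_iff_dvd_diff algebra_simps)
  have "G = (\<Sum>h\<in>{0..<int q}. chi (m * h) * root_char q (m * h * n))"
    unfolding G_def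
    using sum_periodic_coprime_mult[of "\<lambda>h. chi h * root_char q (h * n)" "int q" m] m q_pos
    by (simp add: chi_periodic per)
  also have "\<dots> = chi m * G"
    unfolding e G_def chi_mult sum_distrib_left by (simp add: mult.assoc)
  finally have "G = 0" using m(3) by (metis mult_cancel_right1)
  moreover have "chi n = 0" using False chi_zero_iff by simp
  ultimately show ?thesis by (simp add: G_def)
qed

text \<open>Separability replaces each product of the Gauss sum and a conjugate value by a sum over
  h; after swapping, orthogonality keeps only h = d modulo q. The Gauss sum stays in the numerator,
  so its absolute value never has to be computed.\<close>

lemma chi_fourier:
  "chi d = gauss_sum q chi / of_nat q * (\<Sum>n = 1..q. cnj (chi (int n)) * root_char q (- d * int n))"
proof -
  have per: "root_char q (- d * (n + int q)) = root_char q (- d * n)" for n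
    by (rule periodic_int_cong[of _ "int q"])
       (simp_all add: root_char_periodic q_pos cong_iff_dvd_diff algebra_simps)
  have "gauss_sum q chi * (\<Sum>n = 1..q. cnj (chi (int n)) * root_char q (- d * int n)) =
        gauss_sum q chi * (\<Sum>n\<in>{0..<int q}. cnj (chi n) * root_char q (- d * n))"
    using sum_periodic_nat_int[of "\<lambda>n. cnj (chi n) * root_char q (- d * n)" q] q_pos per
    by (simp add: chi_periodic)
  also have "\<dots> = (\<Sum>n\<in>{0..<int q}. (\<Sum>h\<in>{0..<int q}. chi h * root_char q (h * n)) * root_char q (- d * n))"
    unfolding gauss_sum_separable by (simp add: sum_distrib_left mult_ac)
  also have "\<dots> = (\<Sum>n\<in>{0..<int q}. \<Sum>h\<in>{0..<int q}. chi h * root_char q ((h - d) * n))"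
    unfolding sum_distrib_right
    by (intro sum.cong refl) (simp add: mult.assoc algebra_simps flip: root_char_add)
  also have "\<dots> = (\<Sum>h\<in>{0..<int q}. chi h * (\<Sum>n\<in>{0..<int q}. root_char q ((h - d) * n)))"
    by (subst sum.swap) (simp add: sum_distrib_left)
  also have "\<dots> = (\<Sum>h\<in>{0..<int q}. if h = d mod int q then chi h * of_nat q else 0)"
  proof (intro sum.cong refl)
    fix h assume h: "h \<in> {0..<int q}"
    have "int q dvd h - d \<longleftrightarrow> h = d mod int q"
      using h by (simp add: mod_eq_dvd_iff[symmetric])
    then show "chi h * (\<Sum>n\<in>{0..<int q}. root_char q ((h - d) * n)) =
        (if h = d mod int q then chi h * of_nat q else 0)"
      by (simp add: root_char_orthogonal q_pos)
  qed
  also have "\<dots> = chi d * of_nat q"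
    using q_pos by (simp add: periodic_int_mod[of chi, OF chi_periodic])
  finally show ?thesis using q_pos by (simp add: field_simps)
qed

end

subsection \<open>Partial fractions and the transformation of theta\<close>

text \<open>The cotangent expansion in the variable z = Z / (2 pi i), obtained as the logarithmic
  derivative of the reflection formula for the Gamma function. The partial sums run over 1 / (Z + 2
  pi i j) with -K <= j < K. This lopsided range is the one supplied by the \<open>Digamma\<close>
  series, and it also fits the complete blocks of residues in
  \<open>theta_transform\<close>.\<close>

lemma exp_partial_fractions:
  fixes Z :: complex
  assumes "exp Z \<noteq> 1"
  shows "(\<lambda>K. \<Sum>k<K. 1 / (Z + 2 * pi * \<i> * of_nat k) + 1 / (Z - 2 * pi * \<i> * of_nat (Suc k)))
           \<longlonglongrightarrow> 1 / (exp Z - 1) + 1 / 2"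
proof -
  define z where "z = Z / (2 * pi * \<i>)"
  have Z: "Z = 2 * pi * \<i> * z" by (simp add: z_def)
  have zint: "z \<notin> \<int>"
  proof
    assume "z \<in> \<int>"
    then obtain n where "z = of_int n" by (auto elim: Ints_cases)
    then have "exp Z = 1" unfolding Z exp_eq_1 by (auto intro!: exI[of _ n])
    then show False using assms by simp
  qed
  then have nz: "z \<noteq> 0" "1 - z \<noteq> 0" by auto
  have zint': "1 - z \<notin> \<int>"
    using zint by (metis Ints_1 Ints_diff diff_diff_eq2 add_diff_cancel_left')
  have np: "z \<notin> \<int>\<^sub>\<le>\<^sub>0" "1 - z \<notin> \<int>\<^sub>\<le>\<^sub>0" using zint zint' nonpos_Ints_subset_Ints by auto
  have sin_nz: "sin (of_real pi * w) \<noteq> 0" if "w \<notin> \<int>" for w :: complex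
  proof
    assume "sin (of_real pi * w) = 0"
    then obtain n::int where "of_real pi * w = of_real (of_int n * pi)"
      unfolding sin_eq_0 by auto
    then have "w = of_int n" by (simp add: field_simps)
    then show False using that by simp
  qed
  \<comment> \<open>Both sides of the reflection formula for \<open>rGamma\<close> are
    differentiated; uniqueness of the derivative yields the digamma difference.\<close>
  have "((\<lambda>w. rGamma w * rGamma (1 - w)) has_field_derivative
           rGamma z * rGamma (1 - z) * (Digamma (1 - z) - Digamma z)) (at z)"
    using np by (auto intro!: derivative_eq_intros simp: algebra_simps)
  moreover have "((\<lambda>w. sin (of_real pi * w) / of_real pi) has_field_derivative cos (of_real pi * z)) (at z)"
    by (auto intro!: derivative_eq_intros)
  moreover have "(\<lambda>w::complex. rGamma w * rGamma (1 - w)) = (\<lambda>w. sin (of_real pi * w) / of_real pi)"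
    by (rule ext) (rule rGamma_reflection_complex)
  ultimately have "rGamma z * rGamma (1 - z) * (Digamma (1 - z) - Digamma z) = cos (of_real pi * z)"
    using DERIV_unique by metis
  then have dig: "Digamma (1 - z) - Digamma z = of_real pi * cos (of_real pi * z) / sin (of_real pi * z)"
    using sin_nz[OF zint] by (simp add: rGamma_reflection_complex field_simps)
  \<comment> \<open>The logarithms in the two limits for \<open>Digamma\<close> cancel in the
    difference.\<close>
  have lim: "(\<lambda>K. \<Sum>k<K. 1 / (z + of_nat k) - 1 / (1 - z + of_nat k)) \<longlonglongrightarrow> Digamma (1 - z) - Digamma z"
    using tendsto_diff[OF Digamma_LIMSEQ[OF nz(2)] Digamma_LIMSEQ[OF nz(1)]]
    by (simp add: sum_subtractf inverse_eq_divide)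
  have "(\<lambda>K. 1 / (2 * pi * \<i>) * (\<Sum>k<K. 1 / (z + of_nat k) - 1 / (1 - z + of_nat k)))
           \<longlonglongrightarrow> 1 / (2 * pi * \<i>) * (of_real pi * cos (of_real pi * z) / sin (of_real pi * z))"
    using tendsto_mult_left[OF lim[unfolded dig]] .
  also have "1 / (2 * pi * \<i>) * (of_real pi * cos (of_real pi * z) / sin (of_real pi * z)) =
               1 / (exp Z - 1) + 1 / 2"
  proof -
    \<comment> \<open>In terms of E the exponential is E^2 and the cotangent is rational, so the
      identity becomes algebra.\<close>
    define E where "E = exp (\<i> * (of_real pi * z))"
    have E: "E \<noteq> 0" "exp Z = E * E" "exp (- (\<i> * (of_real pi * z))) = 1 / E"
      by (simp_all add: E_def Z exp_minus field_simps flip: exp_add)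
    have "E * E \<noteq> 1" using assms E by simp
    then show ?thesis
      using E(1) unfolding sin_exp_eq cos_exp_eq E(2) E(3) E_def[symmetric]
      by (simp add: divide_simps) (simp add: algebra_simps)
  qed
  also have "(\<lambda>K. 1 / (2 * pi * \<i>) * (\<Sum>k<K. 1 / (z + of_nat k) - 1 / (1 - z + of_nat k))) =
    (\<lambda>K. \<Sum>k<K. 1 / (Z + 2 * pi * \<i> * of_nat k) + 1 / (Z - 2 * pi * \<i> * of_nat (Suc k)))"
  proof (rule ext, unfold sum_distrib_left, intro sum.cong refl)
    fix k :: nat
    have "Z + 2 * pi * \<i> * of_nat k = 2 * pi * \<i> * (z + of_nat k)"
         "Z - 2 * pi * \<i> * of_nat (Suc k) = - (2 * pi * \<i> * (1 - z + of_nat k))"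
      by (simp_all add: Z algebra_simps)
    then show "1 / (2 * pi * \<i>) * (1 / (z + of_nat k) - 1 / (1 - z + of_nat k)) =
       1 / (Z + 2 * pi * \<i> * of_nat k) + 1 / (Z - 2 * pi * \<i> * of_nat (Suc k))"
      by (simp add: right_diff_distrib)
  qed
  finally show ?thesis .
qed

lemma conjugate_partial_fractions:
  fixes w y :: real
  assumes "w > 0"
  shows "complex_of_real (2 * w / (w\<^sup>2 + y\<^sup>2)) = 1 / (w + \<i> * y) + 1 / (w - \<i> * y)"
proof -
  have nz: "w + \<i> * y \<noteq> 0" "w - \<i> * y \<noteq> 0"
    using assms by (auto simp: complex_eq_iff)
  have "complex_of_real (2 * w / (w\<^sup>2 + y\<^sup>2)) = 2 * w / ((w + \<i> * y) * (w - \<i> * y))"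
    by (simp add: algebra_simps power2_eq_square)
  also have "\<dots> = 1 / (w + \<i> * y) + 1 / (w - \<i> * y)"
    using add_frac_eq[OF nz, of 1 1] by simp
  finally show ?thesis .
qed

lemma summable_inverse_square_plus:
  fixes A B :: real
  assumes "A > 0"
  shows "summable (\<lambda>n. 1 / (B\<^sup>2 + (A * real (Suc n))\<^sup>2))"
proof (rule summable_comparison_test')
  show "summable (\<lambda>n. (1 / A\<^sup>2) * (1 / (real (Suc n))\<^sup>2))"
    using inverse_squares_sums by (intro summable_mult) (auto simp: sums_iff add.commute)
  fix n :: nat
  have "1 / (B\<^sup>2 + (A * real (Suc n))\<^sup>2) \<le> 1 / (A * real (Suc n))\<^sup>2"
    by (intro divide_left_mono mult_pos_pos add_nonneg_pos zero_less_power) (use assms in auto)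
  then show "norm (1 / (B\<^sup>2 + (A * real (Suc n))\<^sup>2)) \<le> (1 / A\<^sup>2) * (1 / (real (Suc n))\<^sup>2)"
    by (simp add: power_mult_distrib)
qed

lemma real_exp_partial_fractions:
  fixes w :: real
  assumes "w > 0"
  shows "(\<lambda>k. 2 * w / (w\<^sup>2 + (2 * pi * real (Suc k))\<^sup>2)) sums (1 / (exp w - 1) - 1 / w + 1 / 2)"
proof -
  define f where "f = (\<lambda>k. 2 * w / (w\<^sup>2 + (2 * pi * real (Suc k))\<^sup>2))"
  define Z where "Z = complex_of_real w"
  have fk: "complex_of_real (f k) =
      1 / (Z + 2 * pi * \<i> * of_nat (Suc k)) + 1 / (Z - 2 * pi * \<i> * of_nat (Suc k))" for k
  proof -
    have y: "2 * pi * \<i> * of_nat (Suc k) = \<i> * complex_of_real (2 * pi * real (Suc k))" by simp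
    show ?thesis
      unfolding f_def Z_def y by (rule conjugate_partial_fractions[OF assms])
  qed
  \<comment> \<open>Shifting the first summand by one index pairs the poles symmetrically. The cost
    is the unpaired term 1 / Z and a boundary term that tends to 0.\<close>
  have part: "(\<Sum>k<K. 1 / (Z + 2 * pi * \<i> * of_nat k) + 1 / (Z - 2 * pi * \<i> * of_nat (Suc k))) =
     (\<Sum>k<K. complex_of_real (f k)) + 1 / Z - 1 / (Z + 2 * pi * \<i> * of_nat K)" for K
  proof -
    define u where "u k = 1 / (Z + 2 * pi * \<i> * of_nat k)" for k :: nat
    define v where "v k = 1 / (Z - 2 * pi * \<i> * of_nat (Suc k))" for k :: nat
    have "(\<Sum>k<K. u k + v k) = (\<Sum>k<K. u (Suc k) + v k) + u 0 - u K"
      by (induction K) (simp_all add: algebra_simps)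
    then show ?thesis by (simp add: fk u_def v_def del: of_nat_Suc)
  qed
  have "exp Z \<noteq> 1"
    using assms unfolding Z_def by (simp add: exp_of_real)
  from exp_partial_fractions[OF this]
  have 1: "(\<lambda>K. (\<Sum>k<K. complex_of_real (f k)) + 1 / Z - 1 / (Z + 2 * pi * \<i> * of_nat K))
     \<longlonglongrightarrow> 1 / (exp Z - 1) + 1 / 2"
    unfolding part .
  have 2: "(\<lambda>K. 1 / (Z + 2 * pi * \<i> * of_nat K)) \<longlonglongrightarrow> 0"
    unfolding divide_inverse mult_1_left
    by (intro filterlim_compose[OF tendsto_inverse_0]
         tendsto_add_filterlim_at_infinity[OF tendsto_const]
         tendsto_mult_filterlim_at_infinity[OF tendsto_const] tendsto_of_nat) auto
  have "(\<lambda>K. ((\<Sum>k<K. complex_of_real (f k)) + 1 / Z - 1 / (Z + 2 * pi * \<i> * of_nat K))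
      + 1 / (Z + 2 * pi * \<i> * of_nat K) - 1 / Z) \<longlonglongrightarrow> (1 / (exp Z - 1) + 1 / 2) + 0 - 1 / Z"
    by (intro tendsto_add tendsto_diff 1 2 tendsto_const)
  then have "(\<lambda>k. complex_of_real (f k)) sums (1 / (exp Z - 1) + 1 / 2 - 1 / Z)"
    by (simp add: sums_def)
  also have "1 / (exp Z - 1) + 1 / 2 - 1 / Z = complex_of_real (1 / (exp w - 1) - 1 / w + 1 / 2)"
    by (simp add: Z_def exp_of_real)
  finally show ?thesis unfolding sums_of_real_iff f_def .
qed

section \<open>The theta series of an even primitive character\<close>

locale even_primitive_dchar = primitive_dchar +
  assumes even: "even_character chi" and nonprincipal: "\<not> principal_character q chi"
begin

lemma chi_minus: "chi (- n) = chi n"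
  using even chi_mult[of "-1" n] by (simp add: even_character_def)

text \<open>A nonzero value would force q = 1, where the only character is principal. Together with
  \<open>chi_q\<close> this allows either end of a residue block to be dropped or added.\<close>

lemma chi_0: "chi 0 = 0"
proof (rule ccontr)
  assume "chi 0 \<noteq> 0"
  then have "q = 1" using chi_zero_iff by simp
  then have "chi n = 1" for n
    using periodic_int_mod[of chi "int q" n] periodic_int_mod[of chi "int q" 1] chi_periodic chi_one by simp
  then show False using nonprincipal by (simp add: principal_character_def)
qed

lemma chi_q: "chi (int q) = 0"
  using chi_periodic[of 0] chi_0 by simp

context
  fixes w :: real
  assumes w: "w > 0"
begin

text \<open>After the finite Fourier expansion each frequency contributes a geometric series with
  ratio \<open>r n\<close>, of modulus exp (-w) < 1.\<close>

lemma theta_fourier: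
  "(\<lambda>d. chi (int (Suc d)) * exp (- w * real (Suc d))) sums
     (gauss_sum q chi / of_nat q * (\<Sum>n = 1..q. cnj (chi (int n)) / (exp (w + 2 * pi * \<i> * of_nat n / of_nat q) - 1)))"
proof -
  define r where "r n = exp (- (w + 2 * pi * \<i> * of_nat n / of_nat q))" for n :: nat
  have nr: "norm (r n) < 1" for n using w by (simp add: r_def)
  have "chi (int (Suc d)) * exp (- w * real (Suc d)) =
        gauss_sum q chi / of_nat q * (\<Sum>n = 1..q. cnj (chi (int n)) * r n ^ Suc d)" for d
  proof -
    have "root_char q (- int (Suc d) * int n) * exp (- w * real (Suc d)) = r n ^ Suc d" for n
    proof -
      have "root_char q (- int (Suc d) * int n) * exp (- w * real (Suc d)) =
        exp (2 * pi * \<i> * of_int (- int (Suc d) * int n) / of_nat q + of_real (- w * real (Suc d)))"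
        unfolding root_char_def exp_add exp_of_real ..
      also have "2 * pi * \<i> * of_int (- int (Suc d) * int n) / of_nat q + of_real (- w * real (Suc d)) =
         of_nat (Suc d) * (- (w + 2 * pi * \<i> * of_nat n / of_nat q))"
        by (simp add: field_simps del: of_nat_Suc)
      also have "exp \<dots> = r n ^ Suc d" unfolding r_def by (rule exp_of_nat_mult)
      finally show ?thesis .
    qed
    then show ?thesis
      by (subst chi_fourier) (simp add: sum_distrib_right mult.assoc del: of_nat_Suc power_Suc)
  qed
  moreover have "(\<lambda>d. gauss_sum q chi / of_nat q * (\<Sum>n = 1..q. cnj (chi (int n)) * r n ^ Suc d)) sums
     (gauss_sum q chi / of_nat q * (\<Sum>n = 1..q. cnj (chi (int n)) * (1 / (exp (w + 2 * pi * \<i> * of_nat n / of_nat q) - 1))))"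
  proof (intro sums_mult sums_sum)
    fix n
    define e where "e = exp (w + 2 * pi * \<i> * of_nat n / of_nat q)"
    have re: "r n = inverse e" unfolding r_def e_def by (rule exp_minus)
    have e0: "e \<noteq> 0" by (simp add: e_def)
    have "r n \<noteq> 1" using nr[of n] by auto
    then have e1: "e \<noteq> 1" using re by auto
    have "(\<lambda>d. r n * r n ^ d) sums (r n * (1 / (1 - r n)))"
      by (intro sums_mult geometric_sums nr)
    also have "r n * (1 / (1 - r n)) = 1 / (e - 1)"
      using e0 e1 unfolding re by (simp add: field_simps)
    finally show "(\<lambda>d. r n ^ Suc d) sums (1 / (exp (w + 2 * pi * \<i> * of_nat n / of_nat q) - 1))"
      by (simp add: e_def)
  qed
  ultimately show ?thesis by simp
qed

text \<open>A form of Poisson summation: each summand of \<open>theta_fourier\<close> is expanded in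
  partial fractions, and the poles belonging to n + k q, over all n and k, exhaust the integers. The
  constants 1/2 are weighted by conjugate character values and add up to 0.\<close>

lemma theta_transform:
  "(\<lambda>d. chi (int (Suc d)) * exp (- w * real (Suc d))) sums
     (gauss_sum q chi / of_nat q *
       (\<Sum>n. cnj (chi (int (Suc n))) * of_real (2 * w / (w\<^sup>2 + (2 * pi / q * real (Suc n))\<^sup>2))))"
proof -
  define b where "b n = complex_of_real (2 * w / (w\<^sup>2 + (2 * pi / q * real n)\<^sup>2))" for n
  define g where "g n = 1 / (w + 2 * pi * \<i> * of_int n / of_nat q)" for n :: int
  have g: "g (int n) + g (- int n) = b n" for n :: nat
  proof -
    define y where "y = 2 * pi / q * real n"
    have y: "2 * pi * \<i> * of_int (int n) / of_nat q = \<i> * complex_of_real y" by (simp add: y_def)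
    have "g (int n) = 1 / (w + \<i> * y)" "g (- int n) = 1 / (w - \<i> * y)"
      unfolding g_def y[symmetric] by simp_all
    then show ?thesis using conjugate_partial_fractions[OF w, of y] by (simp add: b_def y_def)
  qed
  \<comment> \<open>Moving a pole by 2 pi i k amounts to moving the frequency n by q k.\<close>
  have Zk: "1 / (w + 2 * pi * \<i> * of_nat n / of_nat q + 2 * pi * \<i> * of_nat k) = g (int n + int q * int k)"
           "1 / (w + 2 * pi * \<i> * of_nat n / of_nat q - 2 * pi * \<i> * of_nat (Suc k)) = g (int n - int q * int (Suc k))"
     for n k using q_pos by (simp_all add: g_def add_divide_distrib diff_divide_distrib algebra_simps)
  define P where "P K = (\<Sum>n = 1..q. cnj (chi (int n)) *
     (\<Sum>k<K. g (int n + int q * int k) + g (int n - int q * int (Suc k))))" for K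
  have ne1: "exp (w + 2 * pi * \<i> * of_nat n / of_nat q) \<noteq> 1" for n :: nat
    using w by (simp add: exp_eq_1)
  have "P \<longlonglongrightarrow> (\<Sum>n = 1..q. cnj (chi (int n)) * (1 / (exp (w + 2 * pi * \<i> * of_nat n / of_nat q) - 1) + 1 / 2))"
    unfolding P_def Zk[symmetric]
    by (intro tendsto_sum tendsto_mult tendsto_const exp_partial_fractions ne1)
  also have "(\<Sum>n = 1..q. cnj (chi (int n)) * (1 / (exp (w + 2 * pi * \<i> * of_nat n / of_nat q) - 1) + 1 / 2)) =
     (\<Sum>n = 1..q. cnj (chi (int n)) / (exp (w + 2 * pi * \<i> * of_nat n / of_nat q) - 1)) + cnj (\<Sum>n = 1..q. chi (int n)) / 2"
    by (simp add: distrib_left sum.distrib sum_divide_distrib)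
  also have "(\<Sum>n = 1..q. chi (int n)) = 0"
    using sum_periodic_nat_int[of chi, OF chi_periodic q_pos] sum_chi_eq_0[OF nonprincipal] by simp
  finally have P1: "P \<longlonglongrightarrow> (\<Sum>n = 1..q. cnj (chi (int n)) / (exp (w + 2 * pi * \<i> * of_nat n / of_nat q) - 1))"
    by simp
  \<comment> \<open>For $1 \le n \le q$ and $-K \le k < K$ the numbers $n + kq$ run through $-Kq < m \le Kq$, and the
    terms for $m$ and $-m$ combine because the character is even.\<close>
  have P_eq: "P K = (\<Sum>n<K * q. cnj (chi (int (Suc n))) * b (Suc n))" for K
  proof (induction K)
    case (Suc K)
    have c1: "chi (int n) = chi (int n + int q * k)" for n k
      using periodic_int_mult[of chi "int q" "int n" k] chi_periodic by (simp add: mult.commute)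
    have "P (Suc K) = P K + ((\<Sum>n = 1..q. cnj (chi (int n)) * g (int n + int q * int K)) +
        (\<Sum>n = 1..q. cnj (chi (int n)) * g (int n - int q * int (Suc K))))"
      by (simp add: P_def algebra_simps sum.distrib)
    also have "(\<Sum>n = 1..q. cnj (chi (int n)) * g (int n + int q * int K)) =
        (\<Sum>n\<in>{K * q..<Suc K * q}. cnj (chi (int (Suc n))) * g (int (Suc n)))"
      by (rule sum.reindex_bij_witness[of _ "\<lambda>n. Suc n - K * q" "\<lambda>n. n + K * q - 1"])
         (auto simp: c1[of _ "int K"] algebra_simps of_nat_diff)
    \<comment> \<open>Since the character vanishes at 0 and at q, the range 1..q may become 0..<q;
      the reflection of n to (K + 1) q - n then lands exactly on the block used for the positive
      frequencies.\<close>
    also have "(\<Sum>n = 1..q. cnj (chi (int n)) * g (int n - int q * int (Suc K))) =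
        (\<Sum>n<q. cnj (chi (int n)) * g (int n - int q * int (Suc K)))"
      using q_pos
      by (intro sum.mono_neutral_cong) (auto simp: chi_0 chi_q not_less Suc_le_eq)
    also have "\<dots> = (\<Sum>n\<in>{K * q..<Suc K * q}. cnj (chi (int (Suc n))) * g (- int (Suc n)))"
    proof (rule sum.reindex_bij_witness[of _ "\<lambda>n. Suc K * q - Suc n" "\<lambda>n. Suc K * q - Suc n"])
      fix n assume n: "n \<in> {..<q}"
      then have le: "Suc n \<le> Suc K * q" by auto
      have e: "int (Suc (Suc K * q - Suc n)) = - (int n - int q * int (Suc K))"
        using le by (simp add: of_nat_diff algebra_simps)
      show "cnj (chi (int (Suc (Suc K * q - Suc n)))) * g (- int (Suc (Suc K * q - Suc n))) =
            cnj (chi (int n)) * g (int n - int q * int (Suc K))"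
        unfolding e chi_minus using c1[of n "- int (Suc K)"] by (simp add: algebra_simps)
    qed auto
    also have "P K + ((\<Sum>n\<in>{K * q..<Suc K * q}. cnj (chi (int (Suc n))) * g (int (Suc n))) +
        (\<Sum>n\<in>{K * q..<Suc K * q}. cnj (chi (int (Suc n))) * g (- int (Suc n)))) =
       (\<Sum>n<K * q. cnj (chi (int (Suc n))) * b (Suc n)) +
       (\<Sum>n\<in>{K * q..<Suc K * q}. cnj (chi (int (Suc n))) * b (Suc n))"
      unfolding Suc.IH g[symmetric] by (simp add: distrib_left sum.distrib)
    also have "\<dots> = (\<Sum>n<Suc K * q. cnj (chi (int (Suc n))) * b (Suc n))"
      unfolding lessThan_atLeast0 by (rule sum.atLeastLessThan_concat) auto
    finally show ?case .
  qed (simp add: P_def)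
  have sm: "summable (\<lambda>n. cnj (chi (int (Suc n))) * b (Suc n))"
  proof (rule summable_norm_cancel, rule summable_comparison_test')
    show "summable (\<lambda>n. 2 * w * (1 / (w\<^sup>2 + (2 * pi / q * real (Suc n))\<^sup>2)))"
      using q_pos by (intro summable_mult summable_inverse_square_plus) simp
    show "norm (norm (cnj (chi (int (Suc n))) * b (Suc n))) \<le> 2 * w * (1 / (w\<^sup>2 + (2 * pi / q * real (Suc n))\<^sup>2))" for n
    proof -
      have "norm (b (Suc n)) = 2 * w * (1 / (w\<^sup>2 + (2 * pi / q * real (Suc n))\<^sup>2))"
        unfolding b_def norm_of_real using w by (simp add: add_nonneg_nonneg)
      moreover have "norm (norm (cnj (chi (int (Suc n))) * b (Suc n))) = norm (chi (int (Suc n))) * norm (b (Suc n))"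
        by (simp add: norm_mult)
      moreover have "\<dots> \<le> 1 * norm (b (Suc n))"
        by (intro mult_right_mono norm_chi_le_1 norm_ge_zero)
      ultimately show ?thesis by linarith
    qed
  qed
  \<comment> \<open>\<open>P\<close> only gives the partial sums at multiples of q; summability
    identifies their limit with the full series.\<close>
  have "P \<longlonglongrightarrow> (\<Sum>n. cnj (chi (int (Suc n))) * b (Suc n))"
    unfolding P_eq using q_pos
    by (intro filterlim_compose[OF summable_LIMSEQ[OF sm]] mult_nat_right_at_top) auto
  then have "(\<Sum>n. cnj (chi (int (Suc n))) * b (Suc n)) =
     (\<Sum>n = 1..q. cnj (chi (int n)) / (exp (w + 2 * pi * \<i> * of_nat n / of_nat q) - 1))"
    using P1 LIMSEQ_unique by blast
  then show ?thesis using theta_fourier by (simp add: b_def)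
qed

end
end

subsection \<open>Integrals over the half-line\<close>

text \<open>Restricting the space itself excludes u = 0, so pointwise hypotheses on
  \<open>space half_line\<close> can use u > 0 without almost-everywhere statements.\<close>

abbreviation half_line :: "real measure" where
  "half_line \<equiv> restrict_space lborel {0<..}"

lemma half_line_FTC_nonneg:
  fixes f F :: "real \<Rightarrow> real"
  assumes F: "\<And>x. x > 0 \<Longrightarrow> (F has_real_derivative f x) (at x)"
    and f: "\<And>x. x > 0 \<Longrightarrow> isCont f x"
    and nonneg: "\<And>x. x > 0 \<Longrightarrow> f x \<ge> 0"
    and A: "(F \<longlongrightarrow> A) (at_right 0)" and B: "(F \<longlongrightarrow> B) at_top"
  shows "has_bochner_integral half_line f (B - A)"
proof -
  have A': "((F \<circ> real_of_ereal) \<longlongrightarrow> A) (at_right (ereal 0))"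
    and B': "((F \<circ> real_of_ereal) \<longlongrightarrow> B) (at_left \<infinity>)"
    using A B by (simp_all add: ereal_tendsto_simps)
  have *: "einterval (ereal 0) \<infinity> = {0<..}" by (auto simp: einterval_def)
  note FTC = interval_integral_FTC_nonneg[of "ereal 0" \<infinity> F f, OF _ _ _ _ A' B']
  have "set_integrable lborel {0<..} f"
    using FTC(1) F f nonneg by (simp add: *)
  moreover have "(LINT x:{0<..}|lborel. f x) = B - A"
    using FTC(2) F f nonneg by (simp add: interval_lebesgue_integral_le_eq *)
  ultimately show ?thesis
    by (simp add: has_bochner_integral_iff integrable_restrict_space integral_restrict_space
        set_integrable_def set_lebesgue_integral_def)
qed

lemma has_bochner_integral_exp:
  fixes s :: real
  assumes "s > 0"
  shows "has_bochner_integral half_line (\<lambda>u. exp (- s * u)) (1 / s)"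
proof -
  have "has_bochner_integral half_line (\<lambda>u. exp (- s * u)) (0 - (- 1 / s))"
  proof (rule half_line_FTC_nonneg[where F = "\<lambda>u. - exp (- s * u) / s"])
    show "((\<lambda>u. - exp (- s * u) / s) has_real_derivative exp (- s * x)) (at x)" for x
      using assms by (auto intro!: derivative_eq_intros)
    show "((\<lambda>u. - exp (- s * u) / s) \<longlongrightarrow> - 1 / s) (at_right 0)"
      using assms by (auto intro!: tendsto_eq_intros)
    show "((\<lambda>u. - exp (- s * u) / s) \<longlongrightarrow> 0) at_top"
      using assms by real_asymp
  qed auto
  then show ?thesis by simp
qed

lemma has_bochner_integral_arctan:
  fixes c A :: real
  assumes "c > 0" "A > 0"
  shows "has_bochner_integral half_line (\<lambda>u. 2 * c / ((c * u)\<^sup>2 + A\<^sup>2)) (pi / A)"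
proof -
  have pos: "(c * u)\<^sup>2 + A\<^sup>2 > 0" for u using assms by (simp add: add_nonneg_pos)
  have "has_bochner_integral half_line (\<lambda>u. 2 * c / ((c * u)\<^sup>2 + A\<^sup>2)) (pi / A - 0)"
  proof (rule half_line_FTC_nonneg[where F = "\<lambda>u. 2 / A * arctan (c * u / A)"])
    show "((\<lambda>u. 2 / A * arctan (c * u / A)) has_real_derivative 2 * c / ((c * x)\<^sup>2 + A\<^sup>2)) (at x)" for x
    proof -
      have "1 + (c * x / A)\<^sup>2 = ((c * x)\<^sup>2 + A\<^sup>2) / A\<^sup>2"
        using assms by (simp add: field_simps)
      then have "2 / A * ((c / A) * inverse (1 + (c * x / A)\<^sup>2)) = 2 * c / ((c * x)\<^sup>2 + A\<^sup>2)"
        using assms pos[of x] by (simp add: power2_eq_square)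
      then show ?thesis
        using assms by (auto intro!: derivative_eq_intros simp: mult_ac)
    qed
    show "isCont (\<lambda>u. 2 * c / ((c * u)\<^sup>2 + A\<^sup>2)) x" for x
      using pos[of x] by (intro continuous_intros) auto
    show "2 * c / ((c * x)\<^sup>2 + A\<^sup>2) \<ge> 0" for x
      using assms pos[of x] by simp
    show "((\<lambda>u. 2 / A * arctan (c * u / A)) \<longlongrightarrow> 0) (at_right 0)"
      using assms by real_asymp
    show "((\<lambda>u. 2 / A * arctan (c * u / A)) \<longlongrightarrow> pi / A) at_top"
      using assms by real_asymp
  qed
  then show ?thesis by simp
qed

text \<open>Partial fractions in u^2. The number \<open>D\<close> is, up to sign, the resultant of
  the two factors seen as linear polynomials in u^2, and it is nonzero because A B and c^2 are
  distinct positive numbers. The primitive is a difference of two logarithms.\<close>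

lemma has_bochner_integral_log:
  fixes c A B :: real
  assumes "c > 0" "A > 0" "B > 0" and ne: "A * B \<noteq> c\<^sup>2"
  shows "has_bochner_integral half_line (\<lambda>u. u / (((c * u)\<^sup>2 + A\<^sup>2) * (c\<^sup>2 + (B * u)\<^sup>2)))
           (ln (A * B / c\<^sup>2) / ((A * B)\<^sup>2 - c ^ 4))"
proof -
  define D where "D = (A * B)\<^sup>2 - c ^ 4"
  have D: "D \<noteq> 0"
  proof
    assume "D = 0"
    then have "(A * B)\<^sup>2 = (c\<^sup>2)\<^sup>2" by (simp add: D_def)
    then have "A * B = c\<^sup>2" by (rule power2_eq_imp_eq) (use assms in auto)
    then show False using ne by simp
  qed
  have pos: "(c * u)\<^sup>2 + A\<^sup>2 > 0" "c\<^sup>2 + (B * u)\<^sup>2 > 0" for u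
    using assms by (simp_all add: add_nonneg_pos add_pos_nonneg)
  define F where "F = (\<lambda>u. (ln (c\<^sup>2 + (B * u)\<^sup>2) - ln ((c * u)\<^sup>2 + A\<^sup>2)) / (2 * D))"
  have "has_bochner_integral half_line (\<lambda>u. u / (((c * u)\<^sup>2 + A\<^sup>2) * (c\<^sup>2 + (B * u)\<^sup>2)))
     ((ln (B\<^sup>2) - ln (c\<^sup>2)) / (2 * D) - (ln (c\<^sup>2) - ln (A\<^sup>2)) / (2 * D))"
  proof (rule half_line_FTC_nonneg[where F = F])
    show "(F has_real_derivative x / (((c * x)\<^sup>2 + A\<^sup>2) * (c\<^sup>2 + (B * x)\<^sup>2))) (at x)" for x
    proof -
      have "(F has_real_derivative (2 * B\<^sup>2 * x / (c\<^sup>2 + (B * x)\<^sup>2) - 2 * c\<^sup>2 * x / ((c * x)\<^sup>2 + A\<^sup>2)) / (2 * D)) (at x)"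
        unfolding F_def using pos[of x]
        by (intro DERIV_cdivide DERIV_diff)
           (auto intro!: derivative_eq_intros simp: power2_eq_square mult_ac)
      also have "2 * B\<^sup>2 * x / (c\<^sup>2 + (B * x)\<^sup>2) - 2 * c\<^sup>2 * x / ((c * x)\<^sup>2 + A\<^sup>2) =
         (2 * B\<^sup>2 * x * ((c * x)\<^sup>2 + A\<^sup>2) - 2 * c\<^sup>2 * x * (c\<^sup>2 + (B * x)\<^sup>2)) / ((c\<^sup>2 + (B * x)\<^sup>2) * ((c * x)\<^sup>2 + A\<^sup>2))"
        using pos[of x] by (subst diff_frac_eq) auto
      also have "2 * B\<^sup>2 * x * ((c * x)\<^sup>2 + A\<^sup>2) - 2 * c\<^sup>2 * x * (c\<^sup>2 + (B * x)\<^sup>2) = (2 * D) * x"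
        by (simp add: D_def power2_eq_square power4_eq_xxxx algebra_simps)
      finally show ?thesis using D by (simp add: mult_ac)
    qed
    show "isCont (\<lambda>u. u / (((c * u)\<^sup>2 + A\<^sup>2) * (c\<^sup>2 + (B * u)\<^sup>2))) x" for x
      using pos[of x] by (intro continuous_intros) auto
    show "x / (((c * x)\<^sup>2 + A\<^sup>2) * (c\<^sup>2 + (B * x)\<^sup>2)) \<ge> 0" if "x > 0" for x
      using pos[of x] that by simp
    have "isCont F 0" unfolding F_def using pos[of 0] D by (intro continuous_intros) auto
    then have "(F \<longlongrightarrow> F 0) (at_right 0)"
      unfolding isCont_def by (rule filterlim_mono) (auto simp: at_le)
    then show "(F \<longlongrightarrow> (ln (c\<^sup>2) - ln (A\<^sup>2)) / (2 * D)) (at_right 0)"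
      by (simp add: F_def)
    \<comment> \<open>Each logarithm diverges at infinity, so the limit is taken of the quotient
      inside a single logarithm.\<close>
    have "((\<lambda>u. (c\<^sup>2 + (B * u)\<^sup>2) / ((c * u)\<^sup>2 + A\<^sup>2)) \<longlongrightarrow> B\<^sup>2 * inverse (c\<^sup>2)) at_top"
      using assms by real_asymp
    then have "((\<lambda>u. ln ((c\<^sup>2 + (B * u)\<^sup>2) / ((c * u)\<^sup>2 + A\<^sup>2)) / (2 * D)) \<longlongrightarrow> ln (B\<^sup>2 / c\<^sup>2) / (2 * D)) at_top"
      using assms D unfolding divide_inverse[of "B\<^sup>2"]
      by (intro tendsto_divide tendsto_ln tendsto_const) auto
    also have "(\<lambda>u. ln ((c\<^sup>2 + (B * u)\<^sup>2) / ((c * u)\<^sup>2 + A\<^sup>2)) / (2 * D)) = F"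
      unfolding F_def using pos assms by (intro ext) (simp add: ln_div)
    finally show "(F \<longlongrightarrow> (ln (B\<^sup>2) - ln (c\<^sup>2)) / (2 * D)) at_top"
      using assms by (simp add: ln_div)
  qed
  also have "(ln (B\<^sup>2) - ln (c\<^sup>2)) / (2 * D) - (ln (c\<^sup>2) - ln (A\<^sup>2)) / (2 * D) = ln (A * B / c\<^sup>2) / D"
    using assms D by (simp add: ln_div ln_mult ln_realpow field_simps)
  finally show ?thesis by (simp add: D_def)
qed

section \<open>The Bessel function K_0: decay and integral representations\<close>

text \<open>With y = z cosh t, the bounds (y/4)^4 <= exp y and y >= z exp t / 2 give the constant
  4^4 * 2^4 = 4096. The fourth power is chosen so that K_0 at a multiple of sqrt N decays like
  N^(-2), enough for an absolutely convergent double sum.\<close>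

lemma exp_minus_mult_cosh_le:
  fixes z t :: real
  assumes "z > 0" "t \<ge> 0"
  shows "exp (- z * cosh t) \<le> 4096 / z ^ 4 * exp (- t)"
proof -
  define y where "y = z * cosh t"
  have y: "y \<ge> z * exp t / 2"
    using assms by (simp add: y_def cosh_def)
  have ypos: "y > 0"
    using assms by (simp add: y_def cosh_real_pos)
  have "y / 4 \<le> exp (y / 4)"
    using exp_ge_add_one_self[of "y / 4"] by linarith
  then have "(y / 4) ^ 4 \<le> exp (y / 4) ^ 4"
    using ypos by (intro power_mono) auto
  also have "\<dots> = exp y" using exp_of_nat_mult[of 4 "y / 4"] by simp
  finally have "y ^ 4 / 256 \<le> exp y" by (simp add: power_divide)
  moreover have "(z * exp t / 2) ^ 4 \<le> y ^ 4"
    using y assms by (intro power_mono) auto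
  moreover have "exp t \<le> exp t ^ 4"
    using assms self_le_power[of "exp t" 4] by simp
  then have "z ^ 4 * exp t / 16 \<le> (z * exp t / 2) ^ 4"
    using assms by (simp add: power_divide power_mult_distrib)
  ultimately have "z ^ 4 * exp t / 4096 \<le> exp y" by linarith
  then have "inverse (exp y) \<le> inverse (z ^ 4 * exp t / 4096)"
    using assms by (intro le_imp_inverse_le) auto
  then show ?thesis by (simp add: y_def exp_minus field_simps)
qed

text \<open>The definition uses the gauge integral over the closed half-line; the majorant gives
  Lebesgue integrability, and removing the point 0 changes nothing.\<close>

lemma bessel_K0_half_line:
  fixes z :: real
  assumes "z > 0"
  shows "has_bochner_integral half_line (\<lambda>t. exp (- z * cosh t)) (bessel_K0 z)"
    and "bessel_K0 z \<le> 4096 / z ^ 4"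
proof -
  have dom: "has_bochner_integral half_line (\<lambda>t. 4096 / z ^ 4 * exp (- t)) (4096 / z ^ 4 * 1)"
    using has_bochner_integral_exp[of 1] by (intro has_bochner_integral_mult_right) auto
  have meas: "(\<lambda>t. exp (- z * cosh t)) \<in> borel_measurable half_line"
    by (intro measurable_restrict_space1) (simp add: cosh_def)
  have int: "integrable half_line (\<lambda>t. exp (- z * cosh t))"
    by (rule Bochner_Integration.integrable_bound[OF _ meas, of "\<lambda>t. 4096 / z ^ 4 * exp (- t)"])
       (use dom exp_minus_mult_cosh_le[OF assms] assms in
        \<open>auto simp: has_bochner_integral_iff AE_restrict_space_iff\<close>)
  have "(LINT t:{0<..}|lborel. exp (- z * cosh t)) = integral {0<..} (\<lambda>t. exp (- z * cosh t))"
    using int by (intro set_borel_integral_eq_integral)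
      (simp add: integrable_restrict_space set_integrable_def)
  also have "\<dots> = bessel_K0 z"
    unfolding bessel_K0_def
    by (rule integral_spike_set) (auto intro: negligible_subset[of "{0}"])
  finally show K: "has_bochner_integral half_line (\<lambda>t. exp (- z * cosh t)) (bessel_K0 z)"
    using int by (simp add: has_bochner_integral_iff integral_restrict_space set_lebesgue_integral_def)
  have "bessel_K0 z \<le> 4096 / z ^ 4 * 1"
    using has_bochner_integral_integral_eq[OF K] has_bochner_integral_integral_eq[OF dom]
      integral_mono[of half_line "\<lambda>t. exp (- z * cosh t)" "\<lambda>t. 4096 / z ^ 4 * exp (- t)"]
      int dom exp_minus_mult_cosh_le[OF assms]
    by (auto simp: has_bochner_integral_iff space_restrict_space)
  then show "bessel_K0 z \<le> 4096 / z ^ 4" by simp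
qed

lemma bessel_K0_real_line:
  fixes z :: real
  assumes "z > 0"
  shows "has_bochner_integral lborel (\<lambda>t. exp (- z * cosh t)) (2 * bessel_K0 z)"
proof -
  define h where "h t = indicator {0<..} t * exp (- z * cosh t)" for t :: real
  have h: "has_bochner_integral lborel h (bessel_K0 z)"
    using bessel_K0_half_line(1)[OF assms]
    by (simp add: has_bochner_integral_iff integrable_restrict_space integral_restrict_space h_def[abs_def])
  have h': "has_bochner_integral lborel (\<lambda>t. h (- t)) (bessel_K0 z)"
    using h lborel_integrable_real_affine_iff[of "-1" h 0] lborel_integral_real_affine[of "-1" h 0]
    by (simp add: has_bochner_integral_iff)
  have "has_bochner_integral lborel (\<lambda>t. h t + h (- t)) (bessel_K0 z + bessel_K0 z)"
    by (intro has_bochner_integral_add h h')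
  moreover have "AE t in lborel. h t + h (- t) = exp (- z * cosh t)"
    using AE_lborel_singleton[of "0::real"]
    by eventually_elim (auto simp: h_def indicator_def)
  ultimately show ?thesis
    using h by (subst (asm) has_bochner_integral_cong_AE[where g = "\<lambda>t. exp (- z * cosh t)"])
       (auto simp: cosh_def h_def[abs_def])
qed

text \<open>The substitution u = p exp t with p = sqrt (r / s) balances the two terms of the
  exponent: s u and r / u become z/2 times exp t and exp (-t), whose sum is z cosh t.\<close>

lemma bessel_K0_integral:
  fixes s r :: real
  assumes "s > 0" "r > 0"
  shows "has_bochner_integral half_line (\<lambda>u. exp (- s * u - r / u) / u) (2 * bessel_K0 (2 * sqrt (s * r)))"
proof -
  define z where "z = 2 * sqrt (s * r)"
  define p where "p = sqrt (r / s)"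
  have z: "z > 0" and p: "p > 0" using assms by (simp_all add: z_def p_def)
  have sp: "s * p = z / 2" "r / p = z / 2"
    using assms by (simp_all add: z_def p_def real_sqrt_divide real_sqrt_mult field_simps)
  define f where "f u = exp (- s * u - r / u) / u" for u
  have fg: "f (p * exp t) * (p * exp t) = exp (- z * cosh t)" for t
  proof -
    have "- s * (p * exp t) - r / (p * exp t) = - (s * p) * exp t - (r / p) * exp (- t)"
      by (simp add: exp_minus field_simps)
    also have "\<dots> = - z * cosh t" unfolding sp by (simp add: cosh_def field_simps)
    finally show ?thesis using p by (simp add: f_def)
  qed
  have K: "has_bochner_integral lborel (\<lambda>t. exp (- z * cosh t)) (2 * bessel_K0 z)"
    by (rule bessel_K0_real_line[OF z])
  have *: "einterval (ereal 0) \<infinity> = {0<..}" "einterval (-\<infinity>) \<infinity> = UNIV" by (auto simp: einterval_def)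
  have lim: "((ereal \<circ> (\<lambda>t. p * exp t) \<circ> real_of_ereal) \<longlongrightarrow> ereal 0) (at_right (- \<infinity>))"
    "((ereal \<circ> (\<lambda>t. p * exp t) \<circ> real_of_ereal) \<longlongrightarrow> \<infinity>) (at_left \<infinity>)"
    unfolding ereal_tendsto_simps using p by real_asymp+
  note S = interval_integral_substitution_nonneg
    [of "-\<infinity>" \<infinity> "\<lambda>t. p * exp t" "\<lambda>t. p * exp t" f, OF _ _ _ _ _ _ lim]
  have cont: "isCont f (p * exp t)" for t
    unfolding f_def using p by (intro continuous_intros) auto
  have D: "((\<lambda>t. p * exp t) has_real_derivative p * exp t) (at t)" for t
    by (auto intro!: derivative_eq_intros)
  have nn: "f (p * exp t) \<ge> 0" "p * exp t \<ge> 0" for t using p by (simp_all add: f_def)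
  have int: "set_integrable lborel (einterval (-\<infinity>) \<infinity>) (\<lambda>t. f (p * exp t) * (p * exp t))"
    using K by (simp add: fg * set_integrable_def has_bochner_integral_iff)
  have "set_integrable lborel {0<..} f"
    using S(1) cont D nn int by (simp add: *)
  moreover have "(LBINT u:{0<..}. f u) = (LBINT t:UNIV. exp (- z * cosh t))"
    using S(2) cont D nn int by (simp add: interval_lebesgue_integral_le_eq * fg)
  ultimately show ?thesis
    using has_bochner_integral_integral_eq[OF K]
    by (simp add: has_bochner_integral_iff integrable_restrict_space integral_restrict_space
        set_integrable_def set_lebesgue_integral_def z_def f_def[abs_def])
qed

subsection \<open>Interchanging sums and integrals\<close>

lemma norm_sum_antimono_le:
  fixes a :: "nat \<Rightarrow> complex" and b :: "nat \<Rightarrow> real"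
  assumes bound: "\<And>N. norm (\<Sum>n<N. a n) \<le> C" and dec: "decseq b" and nonneg: "\<And>n. b n \<ge> 0"
  shows "norm (\<Sum>n<N. a n * of_real (b n)) \<le> C * b 0"
proof -
  define S where "S N = (\<Sum>n<N. a n)" for N
  have "(\<Sum>n<N. a n * of_real (b n)) = S N * of_real (b N) + (\<Sum>n<N. S (Suc n) * of_real (b n - b (Suc n)))"
    by (induction N) (simp_all add: S_def algebra_simps)
  also have "norm \<dots> \<le> norm (S N * of_real (b N)) + (\<Sum>n<N. norm (S (Suc n) * of_real (b n - b (Suc n))))"
    by (rule order_trans[OF norm_triangle_ineq add_left_mono[OF norm_sum]])
  also have "\<dots> \<le> C * b N + (\<Sum>n<N. C * (b n - b (Suc n)))"
  proof (intro add_mono sum_mono)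
    show "norm (S N * of_real (b N)) \<le> C * b N"
      using mult_right_mono[OF bound[of N] nonneg[of N]] nonneg[of N] by (simp add: norm_mult S_def)
    fix n
    have "b n - b (Suc n) \<ge> 0" using dec by (simp add: decseq_Suc_iff)
    then show "norm (S (Suc n) * of_real (b n - b (Suc n))) \<le> C * (b n - b (Suc n))"
      using mult_right_mono[OF bound[of "Suc n"], of "b n - b (Suc n)"]
      by (simp add: norm_mult S_def del: of_real_diff sum.lessThan_Suc)
  qed
  also have "\<dots> = C * b 0"
    by (simp add: sum_lessThan_telescope' flip: sum_distrib_left) (simp add: algebra_simps)
  finally show ?thesis .
qed

text \<open>Every partial sum is dominated by \<open>C * b 0 u\<close>, integrable because
  \<open>b 0\<close> is. Absolute convergence of the integrated series is not assumed, so the lemma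
  covers series such as the one for L(1, chi).\<close>

lemma abel_dominated_convergence:
  fixes a :: "nat \<Rightarrow> complex" and b :: "nat \<Rightarrow> 'a \<Rightarrow> real"
  assumes bound: "\<And>N. norm (\<Sum>n<N. a n) \<le> C"
    and int: "\<And>n. has_bochner_integral M (b n) (I n)"
    and dec: "\<And>u. u \<in> space M \<Longrightarrow> decseq (\<lambda>n. b n u)"
    and nonneg: "\<And>n u. u \<in> space M \<Longrightarrow> b n u \<ge> 0"
    and H: "\<And>u. u \<in> space M \<Longrightarrow> (\<lambda>n. a n * of_real (b n u)) sums H u"
  shows "integrable M H" and "(\<lambda>n. a n * of_real (I n)) sums integral\<^sup>L M H"
proof -
  have [measurable]: "b n \<in> borel_measurable M" for n
    using int by (intro borel_measurable_integrable) (rule integrable.intros)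
  define s where "s N u = (\<Sum>n<N. a n * of_real (b n u))" for N u
  have s: "s N \<in> borel_measurable M" for N
    unfolding s_def by measurable
  have lim: "(\<lambda>N. s N u) \<longlonglongrightarrow> H u" if "u \<in> space M" for u
    using H[OF that] by (simp add: sums_def s_def)
  have Hm: "H \<in> borel_measurable M"
    by (rule borel_measurable_LIMSEQ_metric[OF s lim])
  have w: "integrable M (\<lambda>u. C * b 0 u)"
    using int[of 0] by (intro integrable_mult_right) (rule integrable.intros)
  have le: "norm (s N u) \<le> C * b 0 u" if "u \<in> space M" for N u
    unfolding s_def using norm_sum_antimono_le[OF bound dec[OF that] nonneg[OF that]] .
  show "integrable M H"
    by (rule integrable_dominated_convergence[of H M s "\<lambda>u. C * b 0 u", OF Hm s w]) (use lim le in auto)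
  have "(\<lambda>N. integral\<^sup>L M (s N)) \<longlonglongrightarrow> integral\<^sup>L M H"
    by (rule integral_dominated_convergence[of H M s "\<lambda>u. C * b 0 u", OF Hm s w]) (use lim le in auto)
  moreover have "integral\<^sup>L M (s N) = (\<Sum>n<N. a n * of_real (I n))" for N
  proof -
    have "has_bochner_integral M (s N) (\<Sum>n<N. a n * of_real (I n))"
      unfolding s_def
      by (intro has_bochner_integral_sum has_bochner_integral_mult_right has_bochner_integral_of_real int)
    then show ?thesis by (rule has_bochner_integral_integral_eq)
  qed
  ultimately show "(\<lambda>n. a n * of_real (I n)) sums integral\<^sup>L M H"
    by (simp add: sums_def)
qed

text \<open>An enumeration of the pairs reduces the claim to termwise integration of a sequence. The
  conclusion is kept as an unconditional sum because the pairs are regrouped by their product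
  afterwards.\<close>

lemma has_sum_integral_pairs:
  fixes F :: "nat \<times> nat \<Rightarrow> 'a \<Rightarrow> complex"
  assumes int: "\<And>p. integrable M (F p)"
    and sm: "(\<lambda>p. \<integral>x. norm (F p x) \<partial>M) summable_on UNIV"
    and G: "\<And>x. x \<in> space M \<Longrightarrow> ((\<lambda>p. F p x) has_sum G x) UNIV"
  shows "integrable M G" and "((\<lambda>p. integral\<^sup>L M (F p)) has_sum integral\<^sup>L M G) UNIV"
proof -
  define e where "e = prod_decode"
  have e: "bij_betw e UNIV UNIV" unfolding e_def by (rule bij_prod_decode)
  have G1: "((\<lambda>n. F (e n) x) has_sum G x) UNIV" if "x \<in> space M" for x
    using G[OF that] by (subst has_sum_reindex_bij_betw[OF e, of "\<lambda>p. F p x"])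
  have G2: "(\<Sum>n. F (e n) x) = G x" if "x \<in> space M" for x
    using has_sum_imp_sums[OF G1[OF that]] by (simp add: sums_iff)
  \<comment> \<open>Unconditional summability of complex numbers is absolute.\<close>
  have G3: "summable (\<lambda>n. norm (F (e n) x))" if "x \<in> space M" for x
  proof (rule summable_on_imp_summable)
    have "(\<lambda>n. F (e n) x) summable_on UNIV" using G1[OF that] by (rule has_sum_imp_summable)
    then show "(\<lambda>n. norm (F (e n) x)) summable_on UNIV"
      by (subst (asm) summable_on_iff_abs_summable_on_complex)
  qed
  have s1: "summable (\<lambda>n. \<integral>x. norm (F (e n) x) \<partial>M)"
    by (rule summable_on_imp_summable)
       (subst summable_on_reindex_bij_betw[OF e, of "\<lambda>p. \<integral>x. norm (F p x) \<partial>M"], rule sm)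
  have ae: "AE x in M. summable (\<lambda>n. norm (F (e n) x))" using G3 by simp
  have "integrable M (\<lambda>x. \<Sum>n. F (e n) x)"
    by (rule integrable_suminf[OF int ae s1])
  then show "integrable M G"
    by (subst (asm) Bochner_Integration.integrable_cong[OF refl, where g = G]) (auto simp: G2)
  have "(\<lambda>n. integral\<^sup>L M (F (e n))) sums (\<integral>x. (\<Sum>n. F (e n) x) \<partial>M)"
    by (rule sums_integral[OF int ae s1])
  also have "(\<integral>x. (\<Sum>n. F (e n) x) \<partial>M) = integral\<^sup>L M G"
    by (rule Bochner_Integration.integral_cong) (auto simp: G2)
  finally have sums: "(\<lambda>n. integral\<^sup>L M (F (e n))) sums integral\<^sup>L M G" .
  have "summable (\<lambda>n. norm (integral\<^sup>L M (F (e n))))"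
    by (rule summable_comparison_test'[OF s1]) simp
  then have "((\<lambda>n. integral\<^sup>L M (F (e n))) has_sum integral\<^sup>L M G) UNIV"
    by (rule norm_summable_imp_has_sum[OF _ sums])
  then show "((\<lambda>p. integral\<^sup>L M (F p)) has_sum integral\<^sup>L M G) UNIV"
    by (subst (asm) has_sum_reindex_bij_betw[OF e, of "\<lambda>p. integral\<^sup>L M (F p)"])
qed

lemma summable_on_product_nonneg:
  fixes f g :: "nat \<Rightarrow> real"
  assumes f: "summable f" "\<And>n. f n \<ge> 0" and g: "summable g" "\<And>n. g n \<ge> 0"
  shows "(\<lambda>(i, j). f i * g j) summable_on UNIV"
proof -
  have hs: "(h has_sum suminf h) UNIV" if "summable h" "\<And>n. h n \<ge> 0" for h :: "nat \<Rightarrow> real"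
    using norm_summable_imp_has_sum[of h "suminf h"] that by (simp add: summable_sums)
  have "(\<lambda>(i, j). f i * g j) summable_on Sigma UNIV (\<lambda>_. UNIV)"
  proof (rule summable_on_SigmaI)
    show "((\<lambda>j. case (i, j) of (i, j) \<Rightarrow> f i * g j) has_sum f i * suminf g) UNIV" for i
      using has_sum_cmult_right[OF hs[OF g]] by simp
    show "(\<lambda>i. f i * suminf g) summable_on UNIV"
      using hs[OF f] by (intro summable_on_cmult_left) (auto simp: summable_on_def)
  qed (use f g in auto)
  then show ?thesis by simp
qed

lemma has_sum_product:
  fixes f g :: "nat \<Rightarrow> complex"
  assumes f: "summable (\<lambda>n. norm (f n))" "f sums A" and g: "summable (\<lambda>n. norm (g n))" "g sums B"
  shows "((\<lambda>(i, j). f i * g j) has_sum A * B) UNIV"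
proof -
  have "((\<lambda>(i, j). f i * g j) has_sum A * B) (Sigma UNIV (\<lambda>_. UNIV))"
  proof (rule has_sum_SigmaI)
    show "((\<lambda>j. case (i, j) of (i, j) \<Rightarrow> f i * g j) has_sum f i * B) UNIV" for i
      using has_sum_cmult_right[OF norm_summable_imp_has_sum[OF g]] by simp
    show "((\<lambda>i. f i * B) has_sum A * B) UNIV"
      by (intro has_sum_cmult_left norm_summable_imp_has_sum[OF f])
    have "(\<lambda>p. norm (case p of (i, j) \<Rightarrow> f i * g j)) summable_on UNIV"
      using summable_on_product_nonneg[OF f(1) _ g(1)] by (simp add: case_prod_unfold norm_mult)
    then show "(\<lambda>(i, j). f i * g j) summable_on Sigma UNIV (\<lambda>_. UNIV)"
      by (simp add: summable_on_iff_abs_summable_on_complex)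
  qed
  then show ?thesis by simp
qed

text \<open>Regrouping by the product: the pair (i, j) corresponds to the divisor i + 1 of (i + 1)(j
  + 1). The shifts arise because series are indexed from 0.\<close>

lemma sums_divisor_sum:
  fixes f g :: "nat \<Rightarrow> complex"
  assumes "((\<lambda>(i, j). f (Suc i) * g (Suc i * Suc j)) has_sum S) UNIV"
  shows "(\<lambda>n. (\<Sum>d | d dvd Suc n. f d) * g (Suc n)) sums S"
proof -
  have "((\<lambda>(n, d). f d * g (Suc n)) has_sum S) (Sigma UNIV (\<lambda>n. {d. d dvd Suc n}))
     \<longleftrightarrow> ((\<lambda>(i, j). f (Suc i) * g (Suc i * Suc j)) has_sum S) UNIV"
  proof (rule has_sum_reindex_bij_witness[where i = "\<lambda>(i, j). (Suc i * Suc j - 1, Suc i)"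
        and j = "\<lambda>(n, d). (d - 1, Suc n div d - 1)"])
    fix p assume "p \<in> Sigma UNIV (\<lambda>n. {d. d dvd Suc n})"
    then obtain n d where p: "p = (n, d)" "d dvd Suc n" by auto
    then obtain k where k: "Suc n = d * k" by (auto elim: dvdE)
    then obtain d' k' where d': "d = Suc d'" "k = Suc k'"
      by (metis mult_is_0 nat.distinct(1) not0_implies_Suc)
    have "Suc n div d = k" unfolding k using d' by (intro nonzero_mult_div_cancel_left) simp
    then have 1: "(\<lambda>(n, d). (d - 1, Suc n div d - 1)) p = (d', k')" using p d' by simp
    then show "(\<lambda>(i, j). (Suc i * Suc j - 1, Suc i)) ((\<lambda>(n, d). (d - 1, Suc n div d - 1)) p) = p"
      using p d' k by simp
    show "(case (case p of (n, d) \<Rightarrow> (d - 1, Suc n div d - 1)) of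
        (i, j) \<Rightarrow> f (Suc i) * g (Suc i * Suc j)) = (case p of (n, d) \<Rightarrow> f d * g (Suc n))"
      unfolding 1 using p d' k by simp
  next
    fix p :: "nat \<times> nat"
    obtain i j where p: "p = (i, j)" by force
    have "Suc i * Suc j div Suc i = Suc j" by (rule nonzero_mult_div_cancel_left) simp
    then show "(\<lambda>(n, d). (d - 1, Suc n div d - 1)) ((\<lambda>(i, j). (Suc i * Suc j - 1, Suc i)) p) = p"
      by (simp add: p)
    have "Suc i dvd Suc i * Suc j" by (rule dvd_triv_left)
    then show "(\<lambda>(i, j). (Suc i * Suc j - 1, Suc i)) p \<in> Sigma UNIV (\<lambda>n. {d. d dvd Suc n})"
      by (simp add: p)
  qed auto
  then have "((\<lambda>(n, d). f d * g (Suc n)) has_sum S) (Sigma UNIV (\<lambda>n. {d. d dvd Suc n}))"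
    using assms by simp
  then have "((\<lambda>n. (\<Sum>d | d dvd Suc n. f d) * g (Suc n)) has_sum S) UNIV"
    by (rule has_sum_SigmaD) (auto simp: sum_distrib_right intro!: has_sum_finiteI)
  then show ?thesis by (rule has_sum_imp_sums)
qed

text \<open>With X = exp s the quotient is exp (-s) times the even function s / (2 sinh s). Doubling
  the angle bounds the latter by exp (-|s| / 2), which also covers X < 1. Any exponent below -1
  would make the double sum converge.\<close>

lemma ln_over_square_minus_one_le:
  fixes X :: real
  assumes "X > 0" "X \<noteq> 1"
  shows "ln X / (X\<^sup>2 - 1) \<le> X powr (- 3 / 2)"
proof -
  define s where "s = ln X"
  have X: "X = exp s" using assms by (simp add: s_def)
  have "s \<noteq> 0" using assms X by auto
  have eq: "ln X / (X\<^sup>2 - 1) = exp (- s) * (s / (2 * sinh s))"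
    using \<open>s \<noteq> 0\<close>
    by (simp add: X sinh_def exp_minus power2_eq_square divide_simps)
  have pos: "t / (2 * sinh t) \<le> exp (- \<bar>t\<bar> / 2)" if "t > 0" for t :: real
  proof -
    have "t / 2 \<le> sinh (t / 2)"
      using real_le_x_sinh[of "t / 2"] that by (simp add: sinh_def exp_minus)
    moreover have "exp (t / 2) / 2 \<le> cosh (t / 2)" by (simp add: cosh_def)
    ultimately have "(t / 2) * (exp (t / 2) / 2) \<le> sinh (t / 2) * cosh (t / 2)"
      using that by (intro mult_mono) auto
    also have "\<dots> = sinh t / 2" using sinh_double[of "t / 2"] by simp
    finally have "t * exp (t / 2) \<le> 2 * sinh t" by simp
    moreover have "sinh t > 0" using that by simp
    ultimately show ?thesis using that by (simp add: exp_minus field_simps)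
  qed
  have "s / (2 * sinh s) \<le> exp (- \<bar>s\<bar> / 2)"
    using pos[of s] pos[of "- s"] \<open>s \<noteq> 0\<close> by (cases "s > 0") auto
  moreover have "exp (- \<bar>s\<bar> / 2) \<le> exp (- s / 2)" by simp
  ultimately have "s / (2 * sinh s) \<le> exp (- s / 2)" by linarith
  then have "exp (- s) * (s / (2 * sinh s)) \<le> exp (- s) * exp (- s / 2)"
    by (intro mult_left_mono) auto
  moreover have "exp (- s) * exp (- s / 2) = X powr (- 3 / 2)"
    using assms by (simp add: powr_def s_def flip: exp_add)
  ultimately show ?thesis unfolding eq by simp
qed

subsection \<open>The summation formula\<close>

context even_primitive_dchar
begin

lemma norm_chi_times_le: "norm (chi m * of_real y) \<le> \<bar>y\<bar>"
  using mult_right_mono[OF norm_chi_le_1, of "\<bar>y\<bar>" m] by (simp add: norm_mult)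

lemma norm_sum_cnj_chi_le: "norm (\<Sum>n<N. cnj (chi (int (Suc n)))) \<le> real q"
proof -
  have "(\<Sum>n<N. cnj (chi (int (Suc n)))) = cnj (\<Sum>n<N. chi (int (Suc n)))" by simp
  then show ?thesis using norm_sum_chi_le[OF nonprincipal, of N] by (simp del: cnj_sum)
qed

section \<open>The integral evaluated in two ways, for fixed c\<close>

context
  fixes c :: real
  assumes c: "c > 0"
begin

definition theta :: "real \<Rightarrow> complex" where
  "theta u = (\<Sum>d. chi (int (Suc d)) * exp (- (c * u) * real (Suc d)))"

lemma theta_sums:
  assumes "u > 0"
  shows "(\<lambda>d. chi (int (Suc d)) * exp (- (c * u) * real (Suc d))) sums theta u"
proof -
  have "c * u > 0" using c assms by simp
  from theta_transform[OF this] show ?thesis by (simp add: sums_iff theta_def)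
qed

text \<open>This is \<open>theta u / u\<close> after the transformation, without the factor tau / q.
  Its terms stay bounded at u = 0.\<close>

definition psi :: "real \<Rightarrow> complex" where
  "psi u = (\<Sum>n. cnj (chi (int (Suc n))) * of_real (2 * c / ((c * u)\<^sup>2 + (2 * pi / q * real (Suc n))\<^sup>2)))"

lemma psi_summable:
  "summable (\<lambda>n. norm (cnj (chi (int (Suc n))) * of_real (2 * c / ((c * u)\<^sup>2 + (2 * pi / q * real (Suc n))\<^sup>2))))"
proof (rule summable_comparison_test')
  show "summable (\<lambda>n. 2 * c * (1 / ((c * u)\<^sup>2 + (2 * pi / q * real (Suc n))\<^sup>2)))"
    using q_pos by (intro summable_mult summable_inverse_square_plus) simp
  fix n
  define y where "y = 2 * c / ((c * u)\<^sup>2 + (2 * pi / q * real (Suc n))\<^sup>2)"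
  have "y \<ge> 0" using c by (simp add: y_def)
  moreover have "norm (norm (cnj (chi (int (Suc n))) * of_real y)) \<le> \<bar>y\<bar>"
    using norm_chi_times_le[of "int (Suc n)" y] by (simp add: norm_mult)
  ultimately show "norm (norm (cnj (chi (int (Suc n))) * of_real (2 * c / ((c * u)\<^sup>2 + (2 * pi / q * real (Suc n))\<^sup>2))))
      \<le> 2 * c * (1 / ((c * u)\<^sup>2 + (2 * pi / q * real (Suc n))\<^sup>2))"
    unfolding y_def by simp
qed

lemma psi_sums:
  "(\<lambda>n. cnj (chi (int (Suc n))) * of_real (2 * c / ((c * u)\<^sup>2 + (2 * pi / q * real (Suc n))\<^sup>2))) sums psi u"
  unfolding psi_def by (rule summable_sums[OF summable_norm_cancel[OF psi_summable]])

lemma theta_eq_psi: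
  assumes "u > 0"
  shows "theta u / u = gauss_sum q chi / of_nat q * psi u"
proof -
  have cu: "c * u > 0" using c assms by simp
  have "theta u = gauss_sum q chi / of_nat q *
       (\<Sum>n. cnj (chi (int (Suc n))) * of_real (2 * (c * u) / ((c * u)\<^sup>2 + (2 * pi / q * real (Suc n))\<^sup>2)))"
    using theta_transform[OF cu] by (simp add: theta_def sums_iff)
  also have "(\<lambda>n. cnj (chi (int (Suc n))) * of_real (2 * (c * u) / ((c * u)\<^sup>2 + (2 * pi / q * real (Suc n))\<^sup>2))) =
     (\<lambda>n. of_real u * (cnj (chi (int (Suc n))) * of_real (2 * c / ((c * u)\<^sup>2 + (2 * pi / q * real (Suc n))\<^sup>2))))"
    by (simp add: fun_eq_iff)
  also have "suminf \<dots> = of_real u * psi u"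
    unfolding psi_def by (rule suminf_mult[OF summable_norm_cancel[OF psi_summable]])
  finally show ?thesis using assms by simp
qed

text \<open>The term for d integrates to 1 / (c d), so the integrated series is L(1, chi) /
  c.\<close>

lemma integral_theta:
  "has_bochner_integral half_line theta (dirichlet_L_one chi / c)"
proof -
  note abel = abel_dominated_convergence[of "\<lambda>n. chi (int (Suc n))" "real q" half_line
      "\<lambda>n u. exp (- (c * u) * real (Suc n))" "\<lambda>n. 1 / (c * real (Suc n))" theta]
  have int: "has_bochner_integral half_line (\<lambda>u. exp (- (c * u) * real (Suc n))) (1 / (c * real (Suc n)))" for n
    using has_bochner_integral_exp[of "c * real (Suc n)"] c by (simp add: mult_ac)
  have dec: "decseq (\<lambda>n. exp (- (c * u) * real (Suc n)))" if "u \<in> space half_line" for u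
    using that c by (auto simp: decseq_def space_restrict_space)
  have sums: "(\<lambda>n. chi (int (Suc n)) * of_real (exp (- (c * u) * real (Suc n)))) sums theta u"
    if "u \<in> space half_line" for u
    using theta_sums[of u] that by (simp add: space_restrict_space)
  have i: "integrable half_line theta"
    by (rule abel(1)) (use norm_sum_chi_le[OF nonprincipal] int dec sums in auto)
  have "(\<lambda>n. chi (int (Suc n)) * of_real (1 / (c * real (Suc n)))) sums integral\<^sup>L half_line theta"
    by (rule abel(2)) (use norm_sum_chi_le[OF nonprincipal] int dec sums in auto)
  then have "(\<lambda>n. c * (chi (int (Suc n)) * of_real (1 / (c * real (Suc n))))) sums (c * integral\<^sup>L half_line theta)"
    by (rule sums_mult)
  also have "(\<lambda>n. c * (chi (int (Suc n)) * of_real (1 / (c * real (Suc n))))) = (\<lambda>n. chi (int (Suc n)) / of_nat (Suc n))"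
    using c by (simp add: fun_eq_iff field_simps del: of_nat_Suc)
  finally have "dirichlet_L_one chi = c * integral\<^sup>L half_line theta"
    by (simp add: dirichlet_L_one_def sums_iff)
  then show ?thesis using i c by (simp add: has_bochner_integral_iff)
qed

text \<open>The term for n integrates to pi / (2 pi n / q) = q / (2 n), which accounts for the
  factor q / 2 and the conjugate L-value.\<close>

lemma integral_psi:
  "has_bochner_integral half_line psi (of_nat q / 2 * dirichlet_L_one (conj_character chi))"
proof -
  note abel = abel_dominated_convergence[of "\<lambda>n. cnj (chi (int (Suc n)))" "real q" half_line
      "\<lambda>n u. 2 * c / ((c * u)\<^sup>2 + (2 * pi / q * real (Suc n))\<^sup>2)" "\<lambda>n. pi / (2 * pi / q * real (Suc n))" psi]
  have int: "has_bochner_integral half_line (\<lambda>u. 2 * c / ((c * u)\<^sup>2 + (2 * pi / q * real (Suc n))\<^sup>2))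
       (pi / (2 * pi / q * real (Suc n)))" for n
    using c q_pos by (intro has_bochner_integral_arctan) auto
  have dec: "decseq (\<lambda>n. 2 * c / ((c * u)\<^sup>2 + (2 * pi / q * real (Suc n))\<^sup>2))" for u
    unfolding decseq_def
  proof (intro allI impI divide_left_mono add_left_mono power_mono mult_left_mono)
    show "0 < ((c * u)\<^sup>2 + (2 * pi / q * real (Suc m))\<^sup>2) * ((c * u)\<^sup>2 + (2 * pi / q * real (Suc n))\<^sup>2)" for m n
      using q_pos by (intro mult_pos_pos add_nonneg_pos) auto
  qed (use c q_pos in auto)
  have nonneg: "0 \<le> 2 * c / ((c * u)\<^sup>2 + (2 * pi / q * real (Suc n))\<^sup>2)" for u n
    using c by simp
  have i: "integrable half_line psi"
    by (rule abel(1)[OF norm_sum_cnj_chi_le int dec nonneg psi_sums])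
  have "(\<lambda>n. cnj (chi (int (Suc n))) * of_real (pi / (2 * pi / q * real (Suc n)))) sums integral\<^sup>L half_line psi"
    by (rule abel(2)[OF norm_sum_cnj_chi_le int dec nonneg psi_sums])
  then have "(\<lambda>n. 2 / of_nat q * (cnj (chi (int (Suc n))) * of_real (pi / (2 * pi / q * real (Suc n)))))
      sums (2 / of_nat q * integral\<^sup>L half_line psi)"
    by (rule sums_mult)
  also have "(\<lambda>n. 2 / of_nat q * (cnj (chi (int (Suc n))) * of_real (pi / (2 * pi / q * real (Suc n))))) =
       (\<lambda>n. conj_character chi (int (Suc n)) / of_nat (Suc n))"
    using q_pos by (simp add: fun_eq_iff field_simps conj_character_def del: of_nat_Suc)
  finally have "dirichlet_L_one (conj_character chi) = 2 / of_nat q * integral\<^sup>L half_line psi"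
    by (simp add: dirichlet_L_one_def sums_iff)
  then show ?thesis using i q_pos by (simp add: has_bochner_integral_iff)
qed

definition remainder :: "real \<Rightarrow> real" where
  "remainder u = 1 / (exp (c / u) - 1) - u / c + 1 / 2"

lemma remainder_sums:
  assumes "u > 0"
  shows "(\<lambda>k. 2 * c * u / (c\<^sup>2 + (2 * pi * real (Suc k) * u)\<^sup>2)) sums remainder u"
proof -
  have cu: "c / u > 0" using c assms by simp
  have eq: "2 * (c / u) / ((c / u)\<^sup>2 + B\<^sup>2) = 2 * c * u / (c\<^sup>2 + (B * u)\<^sup>2)" for B
  proof -
    have "(c / u)\<^sup>2 + B\<^sup>2 = (c\<^sup>2 + (B * u)\<^sup>2) / u\<^sup>2"
      using assms by (simp add: field_simps)
    then show ?thesis using assms by (simp add: power2_eq_square)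
  qed
  then show ?thesis
    using real_exp_partial_fractions[OF cu] unfolding eq remainder_def by simp
qed

text \<open>Both factors are absolutely convergent series, so their product is a double series whose
  terms \<open>has_bochner_integral_log\<close> integrates. The hypothesis says that A B never
  equals c^2.\<close>

lemma integral_psi_remainder:
  assumes ne: "\<And>k. k > 0 \<Longrightarrow> c\<^sup>2 * real q / (4 * pi\<^sup>2) \<noteq> real k"
  shows "integrable half_line (\<lambda>u. psi u * of_real (remainder u))"
    and "(\<lambda>n. d_chi (conj_character chi) (Suc n) *
       of_real (4 * c\<^sup>2 * (ln (4 * pi\<^sup>2 / q * real (Suc n) / c\<^sup>2) / ((4 * pi\<^sup>2 / q * real (Suc n))\<^sup>2 - c ^ 4))))
      sums (\<integral>u. psi u * of_real (remainder u) \<partial>half_line)"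
proof -
  define A where "A n = 2 * pi / q * real (Suc n)" for n
  define B where "B k = 2 * pi * real (Suc k)" for k
  define f where "f p u = 4 * c\<^sup>2 * (u / (((c * u)\<^sup>2 + (A (fst p))\<^sup>2) * (c\<^sup>2 + (B (snd p) * u)\<^sup>2)))"
    for p :: "nat \<times> nat" and u
  define Phi where "Phi N = 4 * c\<^sup>2 * (ln (4 * pi\<^sup>2 / q * real N / c\<^sup>2) / ((4 * pi\<^sup>2 / q * real N)\<^sup>2 - c ^ 4))" for N
  define F where "F p u = cnj (chi (int (Suc (fst p)))) * of_real (f p u)" for p u
  have AB: "A i * B j = 4 * pi\<^sup>2 / q * real (Suc i * Suc j)" for i j
    by (simp add: A_def B_def power2_eq_square del: of_nat_Suc mult_Suc mult_Suc_right)
  have pos: "A i > 0" "B j > 0" for i j using q_pos by (simp_all add: A_def B_def)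
  have neq: "A i * B j \<noteq> c\<^sup>2" for i j
  proof
    assume "A i * B j = c\<^sup>2"
    then have "c\<^sup>2 * real q / (4 * pi\<^sup>2) = real (Suc i * Suc j)"
      unfolding AB using q_pos by (simp add: field_simps)
    then show False using ne[of "Suc i * Suc j"] by simp
  qed
  have hf: "has_bochner_integral half_line (f (i, j)) (Phi (Suc i * Suc j))" for i j
    using has_bochner_integral_mult_right[OF has_bochner_integral_log[OF c pos neq], of "4 * c\<^sup>2" i j]
    unfolding f_def Phi_def AB by simp
  have hF: "has_bochner_integral half_line (F (i, j)) (cnj (chi (int (Suc i))) * of_real (Phi (Suc i * Suc j)))" for i j
    unfolding F_def fst_conv
    by (intro has_bochner_integral_mult_right has_bochner_integral_of_real hf)
  have iF: "integrable half_line (F p)" for p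
    using hF[of "fst p" "snd p"] by (auto intro: integrable.intros)
  have fnn: "f p u \<ge> 0" if "u > 0" for p u
    using that by (simp add: f_def)
  have le: "(\<integral>u. norm (F (i, j) u) \<partial>half_line) \<le> Phi (Suc i * Suc j)" for i j
  proof -
    have "(\<integral>u. norm (F (i, j) u) \<partial>half_line) \<le> (\<integral>u. f (i, j) u \<partial>half_line)"
    proof (rule integral_mono)
      show "integrable half_line (f (i, j))" using hf by (auto intro: integrable.intros)
      show "norm (F (i, j) u) \<le> f (i, j) u" if "u \<in> space half_line" for u
        using norm_chi_times_le[of "int (Suc i)" "f (i, j) u"] fnn[of u "(i, j)"] that
        by (simp add: F_def norm_mult space_restrict_space)
    qed (use iF in auto)
    then show ?thesis using has_bochner_integral_integral_eq[OF hf] by simp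
  qed
  have Phi_le: "Phi (Suc i * Suc j) \<le> (4 / c\<^sup>2 * (4 * pi\<^sup>2 / q / c\<^sup>2) powr (- 3 / 2)) *
      (real (Suc i) powr (- 3 / 2) * real (Suc j) powr (- 3 / 2))" for i j
  proof -
    \<comment> \<open>In this variable the integral of a term is 4 / c^2 times ln X / (X^2 - 1), so
      the bound by X^(-3/2) separates into factors in i and j.\<close>
    define X where "X = A i * B j / c\<^sup>2"
    have X: "X > 0" "X \<noteq> 1" using pos neq[of i j] c by (simp_all add: X_def)
    have "Phi (Suc i * Suc j) = 4 * c\<^sup>2 * (ln X / ((A i * B j)\<^sup>2 - c ^ 4))"
      unfolding Phi_def X_def AB ..
    also have "(A i * B j)\<^sup>2 - c ^ 4 = c ^ 4 * (X\<^sup>2 - 1)"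
      using c by (simp add: X_def power_divide right_diff_distrib power_mult_distrib flip: power_mult)
    also have "4 * c\<^sup>2 * (ln X / (c ^ 4 * (X\<^sup>2 - 1))) = 4 / c\<^sup>2 * (ln X / (X\<^sup>2 - 1))"
      using c by (simp add: power2_eq_square power4_eq_xxxx)
    also have "\<dots> \<le> 4 / c\<^sup>2 * X powr (- 3 / 2)"
      using c by (intro mult_left_mono ln_over_square_minus_one_le X) auto
    also have "X = (4 * pi\<^sup>2 / q / c\<^sup>2) * (real (Suc i) * real (Suc j))"
      unfolding X_def AB by (simp del: of_nat_Suc mult_Suc mult_Suc_right)
    also have "4 / c\<^sup>2 * \<dots> powr (- 3 / 2) = (4 / c\<^sup>2 * (4 * pi\<^sup>2 / q / c\<^sup>2) powr (- 3 / 2)) *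
      (real (Suc i) powr (- 3 / 2) * real (Suc j) powr (- 3 / 2))"
    proof -
      have powr: "(k * (y * z)) powr r = k powr r * (y powr r * z powr r)" if "k \<ge> 0" "y \<ge> 0" "z \<ge> 0"
        for k y z r :: real using that by (simp add: powr_mult)
      show ?thesis by (subst powr) simp_all
    qed
    finally show ?thesis .
  qed
  have ps: "summable (\<lambda>n. real (Suc n) powr (- 3 / 2))"
    by (subst summable_Suc_iff) (simp add: summable_real_powr_iff)
  have "(\<lambda>(i, j). real (Suc i) powr (- 3 / 2) * real (Suc j) powr (- 3 / 2)) summable_on UNIV"
    by (rule summable_on_product_nonneg[OF ps _ ps]) auto
  from summable_on_cmult_right[OF this, of "4 / c\<^sup>2 * (4 * pi\<^sup>2 / q / c\<^sup>2) powr (- 3 / 2)"]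
  have sF: "(\<lambda>p. \<integral>u. norm (F p u) \<partial>half_line) summable_on UNIV"
  proof (rule summable_on_comparison_test)
    fix p :: "nat \<times> nat"
    show "(\<integral>u. norm (F p u) \<partial>half_line) \<le> 4 / c\<^sup>2 * (4 * pi\<^sup>2 / q / c\<^sup>2) powr (- 3 / 2) *
       (case p of (i, j) \<Rightarrow> real (Suc i) powr (- 3 / 2) * real (Suc j) powr (- 3 / 2))"
      using order_trans[OF le Phi_le] by (cases p) simp
  qed simp
  have hs: "((\<lambda>p. F p u) has_sum psi u * of_real (remainder u)) UNIV" if "u \<in> space half_line" for u
  proof -
    have u: "u > 0" using that by (simp add: space_restrict_space)
    have r: "summable (\<lambda>k. norm (complex_of_real (2 * c * u / (c\<^sup>2 + (2 * pi * real (Suc k) * u)\<^sup>2))))"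
      unfolding norm_of_real using sums_summable[OF remainder_sums[OF u]] c u by simp
    have "((\<lambda>(i, j). (cnj (chi (int (Suc i))) * of_real (2 * c / ((c * u)\<^sup>2 + (2 * pi / q * real (Suc i))\<^sup>2))) *
        complex_of_real (2 * c * u / (c\<^sup>2 + (2 * pi * real (Suc j) * u)\<^sup>2))) has_sum psi u * of_real (remainder u)) UNIV"
      by (rule has_sum_product[OF psi_summable psi_sums r]) (use remainder_sums[OF u] in \<open>simp only: sums_of_real_iff\<close>)
    also have "(\<lambda>(i, j). (cnj (chi (int (Suc i))) * of_real (2 * c / ((c * u)\<^sup>2 + (2 * pi / q * real (Suc i))\<^sup>2))) *
        complex_of_real (2 * c * u / (c\<^sup>2 + (2 * pi * real (Suc j) * u)\<^sup>2))) = (\<lambda>p. F p u)"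
    proof (rule ext, clarify)
      fix i j
      have "f (i, j) u = 2 * c / ((c * u)\<^sup>2 + (A i)\<^sup>2) * (2 * c * u / (c\<^sup>2 + (B j * u)\<^sup>2))"
        by (simp add: f_def power2_eq_square mult_ac)
      then show "(cnj (chi (int (Suc i))) * of_real (2 * c / ((c * u)\<^sup>2 + (2 * pi / q * real (Suc i))\<^sup>2))) *
        complex_of_real (2 * c * u / (c\<^sup>2 + (2 * pi * real (Suc j) * u)\<^sup>2)) = F (i, j) u"
        by (simp only: F_def fst_conv A_def B_def of_real_mult mult.assoc)
    qed
    finally show ?thesis .
  qed
  show "integrable half_line (\<lambda>u. psi u * of_real (remainder u))"
    by (rule has_sum_integral_pairs(1)[OF iF sF hs])
  have "((\<lambda>p. integral\<^sup>L half_line (F p)) has_sum (\<integral>u. psi u * of_real (remainder u) \<partial>half_line)) UNIV"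
    by (rule has_sum_integral_pairs(2)[OF iF sF hs])
  also have "(\<lambda>p. integral\<^sup>L half_line (F p)) = (\<lambda>(i, j). cnj (chi (int (Suc i))) * of_real (Phi (Suc i * Suc j)))"
    using has_bochner_integral_integral_eq[OF hF] by (auto simp: fun_eq_iff)
  finally have "(\<lambda>n. (\<Sum>d | d dvd Suc n. cnj (chi (int d))) * of_real (Phi (Suc n)))
      sums (\<integral>u. psi u * of_real (remainder u) \<partial>half_line)"
    by (rule sums_divisor_sum[of "\<lambda>d. cnj (chi (int d))" "\<lambda>n. of_real (Phi n)"])
  then show "(\<lambda>n. d_chi (conj_character chi) (Suc n) *
       of_real (4 * c\<^sup>2 * (ln (4 * pi\<^sup>2 / q * real (Suc n) / c\<^sup>2) / ((4 * pi\<^sup>2 / q * real (Suc n))\<^sup>2 - c ^ 4))))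
      sums (\<integral>u. psi u * of_real (remainder u) \<partial>half_line)"
    unfolding d_chi_def conj_character_def Phi_def .
qed

text \<open>Expanding 1 / (exp (c / u) - 1) as a geometric series in exp (- c / u) turns the
  integrand into a double series; the term for (d, m) integrates to twice K_0 at 2 c sqrt (d
  m).\<close>

lemma bessel_sums_integral:
  "(\<lambda>n. d_chi chi (Suc n) * of_real (2 * bessel_K0 (2 * c * sqrt (real (Suc n)))))
     sums (\<integral>u. theta u / u * of_real (1 / (exp (c / u) - 1)) \<partial>half_line)"
proof -
  define f where "f p u = exp (- (c * real (Suc (fst p))) * u - (c * real (Suc (snd p))) / u) / u"
    for p :: "nat \<times> nat" and u
  define K where "K N = 2 * bessel_K0 (2 * c * sqrt (real N))" for N
  define F where "F p u = chi (int (Suc (fst p))) * of_real (f p u)" for p u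
  have hf: "has_bochner_integral half_line (f (i, j)) (K (Suc i * Suc j))" for i j
  proof -
    have "sqrt ((c * real (Suc i)) * (c * real (Suc j))) = sqrt (c\<^sup>2 * real (Suc i * Suc j))"
      by (simp add: power2_eq_square mult_ac del: of_nat_Suc mult_Suc mult_Suc_right)
    also have "\<dots> = c * sqrt (real (Suc i * Suc j))"
      using c by (simp add: real_sqrt_mult)
    finally show ?thesis
      using bessel_K0_integral[of "c * real (Suc i)" "c * real (Suc j)"] c
      unfolding f_def K_def by (simp add: mult.assoc)
  qed
  have hF: "has_bochner_integral half_line (F (i, j)) (chi (int (Suc i)) * of_real (K (Suc i * Suc j)))" for i j
    unfolding F_def fst_conv
    by (intro has_bochner_integral_mult_right has_bochner_integral_of_real hf)
  have iF: "integrable half_line (F p)" for p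
    using hF[of "fst p" "snd p"] by (auto intro: integrable.intros)
  have le: "(\<integral>u. norm (F (i, j) u) \<partial>half_line) \<le> K (Suc i * Suc j)" for i j
  proof -
    have "(\<integral>u. norm (F (i, j) u) \<partial>half_line) \<le> (\<integral>u. f (i, j) u \<partial>half_line)"
    proof (rule integral_mono)
      show "integrable half_line (f (i, j))" using hf by (auto intro: integrable.intros)
      show "norm (F (i, j) u) \<le> f (i, j) u" if "u \<in> space half_line" for u
      proof -
        have "f (i, j) u \<ge> 0" using that by (simp add: f_def space_restrict_space)
        then show ?thesis
          using norm_chi_times_le[of "int (Suc i)" "f (i, j) u"] by (simp add: F_def)
      qed
    qed (use iF in auto)
    then show ?thesis using has_bochner_integral_integral_eq[OF hf] by simp
  qed
  have K_le: "K (Suc i * Suc j) \<le> (512 / c ^ 4) * (1 / (real (Suc i))\<^sup>2 * (1 / (real (Suc j))\<^sup>2))" for i j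
  proof -
    \<comment> \<open>The constant 512 is 2 * 4096 / 2^4; the fourth power turns the square root
      into a square.\<close>
    have "K (Suc i * Suc j) \<le> 2 * (4096 / (2 * c * sqrt (real (Suc i * Suc j))) ^ 4)"
      unfolding K_def using c by (intro mult_left_mono bessel_K0_half_line(2)) (auto simp del: of_nat_Suc of_nat_mult mult_Suc mult_Suc_right)
    also have "(2 * c * sqrt (real (Suc i * Suc j))) ^ 4 = 16 * c ^ 4 * (sqrt (real (Suc i * Suc j)) ^ 2) ^ 2"
      unfolding power_mult_distrib power_mult[symmetric] by simp
    also have "sqrt (real (Suc i * Suc j)) ^ 2 = real (Suc i) * real (Suc j)"
      by (simp del: of_nat_Suc mult_Suc mult_Suc_right)
    finally show ?thesis by (simp add: power_mult_distrib)
  qed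
  have ps: "summable (\<lambda>n. 1 / (real (Suc n))\<^sup>2)"
    using inverse_squares_sums by (auto simp: sums_iff add.commute)
  have "(\<lambda>(i, j). 1 / (real (Suc i))\<^sup>2 * (1 / (real (Suc j))\<^sup>2)) summable_on UNIV"
    by (rule summable_on_product_nonneg[OF ps _ ps]) auto
  from summable_on_cmult_right[OF this, of "512 / c ^ 4"]
  have sF: "(\<lambda>p. \<integral>u. norm (F p u) \<partial>half_line) summable_on UNIV"
  proof (rule summable_on_comparison_test)
    fix p :: "nat \<times> nat"
    show "(\<integral>u. norm (F p u) \<partial>half_line) \<le> 512 / c ^ 4 *
       (case p of (i, j) \<Rightarrow> 1 / (real (Suc i))\<^sup>2 * (1 / (real (Suc j))\<^sup>2))"
      using order_trans[OF le K_le] by (cases p) simp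
  qed simp
  have hs: "((\<lambda>p. F p u) has_sum theta u / u * of_real (1 / (exp (c / u) - 1))) UNIV" if "u \<in> space half_line" for u
  proof -
    have u: "u > 0" using that by (simp add: space_restrict_space)
    have geo: "(\<lambda>j. exp (- w * real (Suc j))) sums (1 / (exp w - 1))" if "w > 0" for w :: real
    proof -
      have "(\<lambda>j. exp (- w) * exp (- w) ^ j) sums (exp (- w) * (1 / (1 - exp (- w))))"
        using that by (intro sums_mult geometric_sums) simp
      also have "exp (- w) * (1 / (1 - exp (- w))) = 1 / (exp w - 1)"
        using that by (simp add: exp_minus field_simps)
      also have "(\<lambda>j. exp (- w) * exp (- w) ^ j) = (\<lambda>j. exp (- w * real (Suc j)))"
        by (rule ext) (simp add: ring_distribs mult.commute[of w] flip: exp_of_nat_mult exp_add)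
      finally show ?thesis .
    qed
    have cu: "c * u > 0" "c / u > 0" using c u by simp_all
    have s1: "summable (\<lambda>d. norm (chi (int (Suc d)) * exp (- (c * u) * real (Suc d))))"
    proof (rule summable_comparison_test'[OF sums_summable[OF geo[OF cu(1)]]])
      fix d :: nat
      show "norm (norm (chi (int (Suc d)) * exp (- (c * u) * real (Suc d)))) \<le> exp (- (c * u) * real (Suc d))"
        using norm_chi_times_le[of "int (Suc d)" "exp (- (c * u) * real (Suc d))"] by simp
    qed
    have s2: "summable (\<lambda>j. norm (complex_of_real (exp (- (c / u) * real (Suc j)))))"
      using sums_summable[OF geo[OF cu(2)]] by simp
    have "((\<lambda>(i, j). (chi (int (Suc i)) * exp (- (c * u) * real (Suc i))) *
        complex_of_real (exp (- (c / u) * real (Suc j)))) has_sum theta u * of_real (1 / (exp (c / u) - 1))) UNIV"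
      by (rule has_sum_product[OF s1 theta_sums[OF u] s2]) (use geo[OF cu(2)] in \<open>simp only: sums_of_real_iff\<close>)
    from has_sum_cmult_right[OF this, of "of_real (1 / u)"]
    have "((\<lambda>p. of_real (1 / u) * (case p of (i, j) \<Rightarrow> (chi (int (Suc i)) * exp (- (c * u) * real (Suc i))) *
        complex_of_real (exp (- (c / u) * real (Suc j))))) has_sum theta u / u * of_real (1 / (exp (c / u) - 1))) UNIV"
      by simp
    also have "(\<lambda>p. of_real (1 / u) * (case p of (i, j) \<Rightarrow> (chi (int (Suc i)) * exp (- (c * u) * real (Suc i))) *
        complex_of_real (exp (- (c / u) * real (Suc j))))) = (\<lambda>p. F p u)"
    proof (rule ext, clarify)
      fix i j
      have "f (i, j) u = 1 / u * (exp (- (c * u) * real (Suc i)) * exp (- (c / u) * real (Suc j)))"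
        unfolding f_def fst_conv snd_conv by (simp add: mult_ac flip: exp_add)
      then show "of_real (1 / u) * ((chi (int (Suc i)) * exp (- (c * u) * real (Suc i))) *
        complex_of_real (exp (- (c / u) * real (Suc j)))) = F (i, j) u"
        by (simp only: F_def fst_conv of_real_mult mult_ac)
    qed
    finally show ?thesis .
  qed
  have "((\<lambda>p. integral\<^sup>L half_line (F p)) has_sum (\<integral>u. theta u / u * of_real (1 / (exp (c / u) - 1)) \<partial>half_line)) UNIV"
    by (rule has_sum_integral_pairs(2)[OF iF sF hs])
  also have "(\<lambda>p. integral\<^sup>L half_line (F p)) = (\<lambda>(i, j). chi (int (Suc i)) * of_real (K (Suc i * Suc j)))"
    using has_bochner_integral_integral_eq[OF hF] by (auto simp: fun_eq_iff)
  finally have "(\<lambda>n. (\<Sum>d | d dvd Suc n. chi (int d)) * of_real (K (Suc n)))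
      sums (\<integral>u. theta u / u * of_real (1 / (exp (c / u) - 1)) \<partial>half_line)"
    by (rule sums_divisor_sum[of "\<lambda>d. chi (int d)" "\<lambda>n. of_real (K n)"])
  then show ?thesis
    unfolding d_chi_def K_def .
qed

lemma bessel_sum_formula:
  assumes ne: "\<And>k. k > 0 \<Longrightarrow> c\<^sup>2 * real q / (4 * pi\<^sup>2) \<noteq> real k"
  shows "(\<lambda>n. d_chi chi (Suc n) * of_real (2 * bessel_K0 (2 * c * sqrt (real (Suc n))))) sums
    (dirichlet_L_one chi / c / c - gauss_sum q chi / of_nat q * (of_nat q / 2 * dirichlet_L_one (conj_character chi)) / 2 +
     gauss_sum q chi / of_nat q * (\<Sum>n. d_chi (conj_character chi) (Suc n) *
       of_real (4 * c\<^sup>2 * (ln (4 * pi\<^sup>2 / q * real (Suc n) / c\<^sup>2) / ((4 * pi\<^sup>2 / q * real (Suc n))\<^sup>2 - c ^ 4)))))"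
    (is "_ sums (?L1 - ?L2 + ?t * ?S)")
proof -
  define R where "R u = psi u * of_real (remainder u)" for u
  have R: "has_bochner_integral half_line R ?S"
    using integral_psi_remainder[OF ne] unfolding has_bochner_integral_iff R_def
    by (simp add: sums_iff del: of_nat_Suc)
  have int: "has_bochner_integral half_line (\<lambda>u. theta u / c - ?t * psi u / 2 + ?t * R u) (?L1 - ?L2 + ?t * ?S)"
    by (intro has_bochner_integral_add has_bochner_integral_diff has_bochner_integral_mult_right
          has_bochner_integral_divide integral_theta integral_psi R)
  \<comment> \<open>Only the first summand keeps \<open>theta\<close>; in the other two
    \<open>theta u / u\<close> is replaced by its transformed form.\<close>
  have eq: "theta u / c - ?t * psi u / 2 + ?t * R u = theta u / u * of_real (1 / (exp (c / u) - 1))"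
    if "u \<in> space half_line" for u
  proof -
    have u: "u > 0" using that by (simp add: space_restrict_space)
    have "1 / (exp (c / u) - 1) = u / c - 1 / 2 + remainder u" by (simp add: remainder_def)
    then have "theta u / u * of_real (1 / (exp (c / u) - 1)) =
       theta u / u * of_real (u / c) - (theta u / u) / 2 + (theta u / u) * of_real (remainder u)"
      by (simp only: of_real_add of_real_diff) (simp add: algebra_simps)
    also have "theta u / u * of_real (u / c) = theta u / c" using u by simp
    finally show ?thesis unfolding theta_eq_psi[OF u] R_def by (simp add: mult.assoc)
  qed
  have "(\<integral>u. theta u / u * of_real (1 / (exp (c / u) - 1)) \<partial>half_line) =
     (\<integral>u. theta u / c - ?t * psi u / 2 + ?t * R u \<partial>half_line)"
    by (rule Bochner_Integration.integral_cong[OF refl]) (rule eq[symmetric])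
  also have "\<dots> = ?L1 - ?L2 + ?t * ?S"
    by (rule has_bochner_integral_integral_eq[OF int])
  finally have "(\<integral>u. theta u / u * of_real (1 / (exp (c / u) - 1)) \<partial>half_line) = ?L1 - ?L2 + ?t * ?S" .
  then show ?thesis using bessel_sums_integral by (simp only:)
qed

end
end

theorem theorem2p9:
  fixes q :: nat and chi :: "int \<Rightarrow> complex" and a x :: real
  assumes "primitive_character q chi"
    and "\<not> principal_character q chi"
    and "even_character chi"
    and "a > 0" and "x > 0"
    and "\<forall>k::nat. k > 0 \<longrightarrow> a\<^sup>2 * real q * x / (16 * pi\<^sup>2) \<noteq> real k"
  shows "(\<Sum>n. d_chi chi (Suc n) * complex_of_real (bessel_K0 (a * sqrt (real (Suc n) * x))))
       = complex_of_real (2 / (a\<^sup>2 * x)) * dirichlet_L_one chi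
         - gauss_sum q chi / 8 * dirichlet_L_one (conj_character chi)
         + complex_of_real (a\<^sup>2 * real q * x / (32 * pi ^ 4)) * gauss_sum q chi *
           (\<Sum>n. d_chi (conj_character chi) (Suc n) *
              complex_of_real (ln (16 * pi\<^sup>2 * real (Suc n) / (a\<^sup>2 * real q * x))
                / ((real (Suc n))\<^sup>2 - (a\<^sup>2 * real q * x / (16 * pi\<^sup>2))\<^sup>2)))"
proof -
  interpret even_primitive_dchar q chi
    using assms by unfold_locales (auto simp: primitive_character_def)
  \<comment> \<open>Chosen so that 2 c sqrt N = a sqrt (N x).\<close>
  define c where "c = a * sqrt x / 2"
  have c: "c > 0" using assms by (simp add: c_def)
  have c2: "c\<^sup>2 = a\<^sup>2 * x / 4" using assms by (simp add: c_def power_divide power_mult_distrib)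
  define rho where "rho = a\<^sup>2 * real q * x / (16 * pi\<^sup>2)"
  have rho: "c\<^sup>2 * real q / (4 * pi\<^sup>2) = rho" by (simp add: c2 rho_def)
  have ne: "c\<^sup>2 * real q / (4 * pi\<^sup>2) \<noteq> real k" if "k > 0" for k
    unfolding rho using assms(6) that by (simp add: rho_def)
  define w where "w n = complex_of_real (ln (16 * pi\<^sup>2 * real (Suc n) / (a\<^sup>2 * real q * x))
                / ((real (Suc n))\<^sup>2 - rho\<^sup>2))" for n
  \<comment> \<open>Extracting 16 pi^4 / q^2 from the denominator leaves N^2 - \<open>rho\<close>^2
    and the factor 4 c^2 q^2 / (16 pi^4).\<close>
  have w: "complex_of_real (4 * c\<^sup>2 * (ln (4 * pi\<^sup>2 / q * real (Suc n) / c\<^sup>2) / ((4 * pi\<^sup>2 / q * real (Suc n))\<^sup>2 - c ^ 4)))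
      = of_real (c\<^sup>2 * q\<^sup>2 / (4 * pi ^ 4)) * w n" for n
  proof -
    have "4 * pi\<^sup>2 / q * real (Suc n) / c\<^sup>2 = 16 * pi\<^sup>2 * real (Suc n) / (a\<^sup>2 * real q * x)"
      by (simp add: c2 field_simps)
    moreover have "(4 * pi\<^sup>2 / q * real (Suc n))\<^sup>2 - c ^ 4 = 16 * pi ^ 4 / q\<^sup>2 * ((real (Suc n))\<^sup>2 - rho\<^sup>2)"
      using q_pos unfolding rho[symmetric]
      by (simp add: power_mult_distrib power_divide right_diff_distrib flip: power_mult del: of_nat_Suc)
    moreover have "4 * c\<^sup>2 * (L / (16 * pi ^ 4 / q\<^sup>2 * D)) = c\<^sup>2 * q\<^sup>2 / (4 * pi ^ 4) * (L / D)" for L D :: real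
      by (simp add: mult_ac)
    ultimately show ?thesis by (simp only: w_def of_real_mult)
  qed
  have K: "a * sqrt (real (Suc n) * x) = 2 * c * sqrt (real (Suc n))" for n
    by (simp add: c_def real_sqrt_mult)
  \<comment> \<open>Convergence, needed for moving the constant out of the infinite sum, is
    inherited from \<open>integral_psi_remainder\<close> by undoing that constant.\<close>
  have sm: "summable (\<lambda>n. d_chi (conj_character chi) (Suc n) * w n)"
  proof -
    have "summable (\<lambda>n. of_real (4 * pi ^ 4 / (c\<^sup>2 * q\<^sup>2)) * (d_chi (conj_character chi) (Suc n) *
        (of_real (c\<^sup>2 * q\<^sup>2 / (4 * pi ^ 4)) * w n)))"
      using sums_summable[OF integral_psi_remainder(2)[OF c ne]] unfolding w by (rule summable_mult)
    then show ?thesis using c q_pos by simp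
  qed
  have "(\<lambda>n. d_chi chi (Suc n) * of_real (2 * bessel_K0 (2 * c * sqrt (real (Suc n))))) sums
    (dirichlet_L_one chi / c / c - gauss_sum q chi / of_nat q * (of_nat q / 2 * dirichlet_L_one (conj_character chi)) / 2 +
     gauss_sum q chi / of_nat q * (\<Sum>n. d_chi (conj_character chi) (Suc n) * (of_real (c\<^sup>2 * q\<^sup>2 / (4 * pi ^ 4)) * w n)))"
    using bessel_sum_formula[OF c ne] unfolding w by simp
  also have "(\<Sum>n. d_chi (conj_character chi) (Suc n) * (of_real (c\<^sup>2 * q\<^sup>2 / (4 * pi ^ 4)) * w n)) =
     of_real (c\<^sup>2 * q\<^sup>2 / (4 * pi ^ 4)) * (\<Sum>n. d_chi (conj_character chi) (Suc n) * w n)"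
    using suminf_mult[OF sm, of "of_real (c\<^sup>2 * q\<^sup>2 / (4 * pi ^ 4))"] by (simp only: mult.left_commute)
  \<comment> \<open>The half undoes the factor 2 that the integral representation attaches to
    K_0.\<close>
  finally have "(\<lambda>n. 1 / 2 * (d_chi chi (Suc n) * of_real (2 * bessel_K0 (2 * c * sqrt (real (Suc n)))))) sums
    (1 / 2 * (dirichlet_L_one chi / c / c - gauss_sum q chi / of_nat q * (of_nat q / 2 * dirichlet_L_one (conj_character chi)) / 2 +
     gauss_sum q chi / of_nat q * (of_real (c\<^sup>2 * q\<^sup>2 / (4 * pi ^ 4)) * (\<Sum>n. d_chi (conj_character chi) (Suc n) * w n))))"
    by (rule sums_mult)
  also have "1 / 2 * (dirichlet_L_one chi / c / c - gauss_sum q chi / of_nat q * (of_nat q / 2 * dirichlet_L_one (conj_character chi)) / 2 +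
     gauss_sum q chi / of_nat q * (of_real (c\<^sup>2 * q\<^sup>2 / (4 * pi ^ 4)) * (\<Sum>n. d_chi (conj_character chi) (Suc n) * w n))) =
     complex_of_real (1 / (2 * c\<^sup>2)) * dirichlet_L_one chi - gauss_sum q chi / 8 * dirichlet_L_one (conj_character chi)
       + complex_of_real (c\<^sup>2 * q / (8 * pi ^ 4)) * gauss_sum q chi * (\<Sum>n. d_chi (conj_character chi) (Suc n) * w n)"
    using q_pos by (simp add: power2_eq_square algebra_simps)
  also have "1 / (2 * c\<^sup>2) = 2 / (a\<^sup>2 * x)" by (simp add: c2)
  also have "c\<^sup>2 * q / (8 * pi ^ 4) = a\<^sup>2 * real q * x / (32 * pi ^ 4)" by (simp add: c2)
  finally show ?thesis
    unfolding K w_def rho_def by (simp add: sums_iff del: of_nat_Suc)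
qed

end
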